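(* Let $N\ge 1$, let $f:Z[1,N]\times\mathbb{R}\to\mathbb{R}$ be continuous in its second variable and odd in its second variable for every $k\in Z[1,N]$, and let $p:Z[1,N+2]\to\mathbb{R}$, $q:Z[1,N+1]\to\mathbb{R}$. Assume that (1) $p_{\min}\ge 0$; (2) $\min_{k\in Z[1,N]}\lim_{s\to\infty}\frac{f(k,s)}{s}>\alpha_1$; (3) $\max_{k\in Z[1,N]}\lim_{s\to0^+}\frac{f(k,s)}{s}<\alpha_2$ (all limits assumed to exist, those at $\infty$ possibly equal to $+\infty$). Then the boundary value problem $$\Delta^2\big(p(k)\Delta^2 y(k-2)\big)+\Delta\big(q(k)\Delta y(k-1)\big)+f(k,y(k))=0\ \ (k\in Z[1,N]),\qquad y(-1)=y(0)=y(N+1)=y(N+2)=0$$ has at least $2N$ distinct solutions.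
   Context: $Z[a,b]=[a,b]\cap\mathbb{Z}$; $\Delta x(k)=x(k+1)-x(k)$, $\Delta^2=\Delta\circ\Delta$; $\Delta^2(p(k)\Delta^2y(k-2))$ means $\Delta^2$ applied to $k\mapsto p(k)\Delta^2 y(k-2)$, similarly for $\Delta(q(k)\Delta y(k-1))$. A solution is a function $y:Z[-1,N+2]\to\mathbb{R}$ satisfying the equation and boundary conditions. $p_{\min},p_{\max}$ are the min and max of $p$ over $Z[1,N+2]$, $q_{\min},q_{\max}$ those of $q$ over $Z[1,N+1]$. Let $E=\{y:Z[-1,N+2]\to\mathbb{R}\mid y(-1)=y(0)=y(N+1)=y(N+2)=0\}$ and $\tilde y=(y(1),\dots,y(N))^T$; $V$ is the $(N+1)\times N$ matrix with $V\tilde y=(\Delta y(0),\dots,\Delta y(N))^T$ and $W$ the $(N+2)\times N$ matrix with $W\tilde y=(\Delta^2y(-1),\dots,\Delta^2y(N))^T$ for $y\in E$; $\lambda_1,\lambda_2$ are the smallest eigenvalues of $V^TV$, $W^TW$. $\eta'(p)=\lambda_2$ if $p_{\min}\ge0$, $16$ if $p_{\min}<0$; $\eta(q)=\lambda_1$ if $q_{\max}<0$, $4$ if $q_{\max}\ge0$; $\xi(q)=\lambda_1$ if $q_{\min}\ge0$, $4$ if $q_{\min}<0$. $\alpha_1=\eta(q)q_{\max}-\eta'(p)p_{\min}$, $\alpha_2=\xi(q)q_{\min}-16p_{\max}$. *)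

theory Defs
  imports Complex_Main "HOL-Library.Extended_Real" "Jordan_Normal_Form.Char_Poly"
begin

definition fdiff :: "(int \<Rightarrow> real) \<Rightarrow> int \<Rightarrow> real" where
  "fdiff x k = x (k + 1) - x k"

definition embedE :: "nat \<Rightarrow> real vec \<Rightarrow> int \<Rightarrow> real" where
  "embedE N v k = (if 1 \<le> k \<and> k \<le> int N then v $ nat (k - 1) else 0)"

text \<open>V: (N+1) x N matrix with V y~ = (Delta y(0), ..., Delta y(N)).\<close>
definition Vmat :: "nat \<Rightarrow> real mat" where
  "Vmat N = mat (N + 1) N (\<lambda>(i, j). fdiff (embedE N (unit_vec N j)) (int i))"

text \<open>W: (N+2) x N matrix with W y~ = (Delta^2 y(-1), ..., Delta^2 y(N)).\<close>
definition Wmat :: "nat \<Rightarrow> real mat" where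
  "Wmat N = mat (N + 2) N (\<lambda>(i, j). fdiff (fdiff (embedE N (unit_vec N j))) (int i - 1))"

definition lambda1 :: "nat \<Rightarrow> real" where
  "lambda1 N = Min {l. eigenvalue (transpose_mat (Vmat N) * Vmat N) l}"

definition lambda2 :: "nat \<Rightarrow> real" where
  "lambda2 N = Min {l. eigenvalue (transpose_mat (Wmat N) * Wmat N) l}"

definition pmin :: "nat \<Rightarrow> (int \<Rightarrow> real) \<Rightarrow> real" where
  "pmin N p = Min (p ` {1..int N + 2})"
definition pmax :: "nat \<Rightarrow> (int \<Rightarrow> real) \<Rightarrow> real" where
  "pmax N p = Max (p ` {1..int N + 2})"
definition qmin :: "nat \<Rightarrow> (int \<Rightarrow> real) \<Rightarrow> real" where
  "qmin N q = Min (q ` {1..int N + 1})"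
definition qmax :: "nat \<Rightarrow> (int \<Rightarrow> real) \<Rightarrow> real" where
  "qmax N q = Max (q ` {1..int N + 1})"

definition eta' :: "nat \<Rightarrow> (int \<Rightarrow> real) \<Rightarrow> real" where
  "eta' N p = (if pmin N p \<ge> 0 then lambda2 N else 16)"
definition eta :: "nat \<Rightarrow> (int \<Rightarrow> real) \<Rightarrow> real" where
  "eta N q = (if qmax N q < 0 then lambda1 N else 4)"
definition xi :: "nat \<Rightarrow> (int \<Rightarrow> real) \<Rightarrow> real" where
  "xi N q = (if qmin N q \<ge> 0 then lambda1 N else 4)"

definition alpha1 :: "nat \<Rightarrow> (int \<Rightarrow> real) \<Rightarrow> (int \<Rightarrow> real) \<Rightarrow> real" where
  "alpha1 N p q = eta N q * qmax N q - eta' N p * pmin N p"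
definition alpha2 :: "nat \<Rightarrow> (int \<Rightarrow> real) \<Rightarrow> (int \<Rightarrow> real) \<Rightarrow> real" where
  "alpha2 N p q = xi N q * qmin N q - 16 * pmax N p"

text \<open>y is a solution of the BVP. Solutions are functions on Z[-1,N+2];
  we represent them canonically as functions int => real vanishing outside Z[-1,N+2].\<close>
definition is_solution :: "nat \<Rightarrow> (int \<Rightarrow> real) \<Rightarrow> (int \<Rightarrow> real) \<Rightarrow> (int \<Rightarrow> real \<Rightarrow> real)
    \<Rightarrow> (int \<Rightarrow> real) \<Rightarrow> bool" where
  "is_solution N p q f y \<longleftrightarrow>
     (\<forall>k. k \<notin> {-1..int N + 2} \<longrightarrow> y k = 0) \<and>
     (\<forall>k\<in>{1..int N}.
        fdiff (fdiff (\<lambda>j. p j * fdiff (fdiff y) (j - 2))) k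
        + fdiff (\<lambda>j. q j * fdiff y (j - 1)) k + f k (y k) = 0) \<and>
     y (-1) = 0 \<and> y 0 = 0 \<and> y (int N + 1) = 0 \<and> y (int N + 2) = 0"

end

theory Submission
  imports "HOL-Homology.Homology" "HOL-Library.Z2" "HOL-Analysis.Interval_Integral" Defs
begin

text \<open>Solutions are the critical points of the even functional
  \<open>J x = (\<Sum> p (\<Delta>\<^sup>2 y)\<^sup>2 - \<Sum> q (\<Delta> y)\<^sup>2) / 2 + \<Sum> F\<^sub>k (y k)\<close>, where \<open>F\<^sub>k\<close> is the even antiderivative of \<open>f k\<close>.
  Assumption (2) makes \<open>J\<close> coercive, assumption (3) makes it negative on a small sphere \<open>S\<close> of \<open>\<real>\<^sup>N\<close>.
  If there were only \<open>m < N\<close> antipodal pairs \<open>\<plusminus>k\<close> of critical points with \<open>J < 0\<close>, then a discrete gradient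
  descent started on \<open>S\<close> would bring every point close to one of them, and never close to both \<open>k\<close> and \<open>-k\<close>
  because the way from \<open>k\<close> to \<open>-k\<close> costs a definite amount of \<open>J\<close>. The points of \<open>S\<close> that come close to \<open>k\<close>
  thus form open sets which, together with their antipodes, cover \<open>S\<close>; this contradicts the
  Lusternik--Schnirelmann theorem. The latter is proved by evaluating a mod 2 cup product of sign
  changes on iterated subdivisions of singular chains that model the hemispheres of the sphere.\<close>

section \<open>The Lusternik--Schnirelmann theorem\<close>

text \<open>A \<open>bit\<close>-valued function \<theta> with \<theta>(-x) = \<theta>(x) + 1 has a
  coboundary that is invariant under the antipode; it represents the generator of H^1(RP^n; Z/2),
  whose powers do not vanish up to degree n. On a connected sphere such a \<theta> cannot be
  continuous, so a constant value is only available on simplices fine enough to lie in one piece of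
  the cover; there one factor of the product dies.

  The obstacle on the analytic side is that each f(k, .) is merely continuous: the gradient of J
  need not be Lipschitz, and a gradient flow need not be unique. A single continuous odd map,
  iterated, replaces the flow. Its price is that orbits jump, so the steps must be short compared
  with the distances between critical points.

  Only critical points with J < 0 are counted because J(0) = 0: this removes the trivial solution,
  the one point equal to its antipode. The number N of pairs comes from the sphere having dimension
  N - 1.\<close>

definition chain_eval :: "('a \<Rightarrow> bit) \<Rightarrow> ('a \<Rightarrow>\<^sub>0 int) \<Rightarrow> bit" where
  "chain_eval \<phi> c = (\<Sum>\<sigma>\<in>Poly_Mapping.keys c. of_int (Poly_Mapping.lookup c \<sigma>) * \<phi> \<sigma>)"

lemma chain_eval_superset:
  assumes "finite K" "Poly_Mapping.keys c \<subseteq> K"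
  shows "chain_eval \<phi> c = (\<Sum>\<sigma>\<in>K. of_int (Poly_Mapping.lookup c \<sigma>) * \<phi> \<sigma>)"
  unfolding chain_eval_def using assms
  by (intro sum.mono_neutral_left) (auto simp: in_keys_iff)

lemma chain_eval_0 [simp]: "chain_eval \<phi> 0 = 0"
  by (simp add: chain_eval_def)

lemma chain_eval_of [simp]: "chain_eval \<phi> (frag_of \<sigma>) = \<phi> \<sigma>"
  by (cases "\<phi> \<sigma>") (simp_all add: chain_eval_def)

lemma chain_eval_diff: "chain_eval \<phi> (a - b) = chain_eval \<phi> a - chain_eval \<phi> b"
proof -
  let ?K = "Poly_Mapping.keys a \<union> Poly_Mapping.keys b"
  have "chain_eval \<phi> (a - b) = (\<Sum>\<sigma>\<in>?K. of_int (Poly_Mapping.lookup (a - b) \<sigma>) * \<phi> \<sigma>)"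
    by (intro chain_eval_superset) (auto simp: in_keys_iff lookup_minus)
  also have "\<dots> = (\<Sum>\<sigma>\<in>?K. of_int (Poly_Mapping.lookup a \<sigma>) * \<phi> \<sigma> - of_int (Poly_Mapping.lookup b \<sigma>) * \<phi> \<sigma>)"
    by (intro sum.cong refl) (simp only: lookup_minus of_int_diff left_diff_distrib)
  also have "\<dots> = chain_eval \<phi> a - chain_eval \<phi> b"
    unfolding sum_subtractf by (subst (1 2) chain_eval_superset[of ?K]) auto
  finally show ?thesis .
qed

lemma chain_eval_minus: "chain_eval \<phi> (- a) = chain_eval \<phi> a"
  using chain_eval_diff[of \<phi> 0 a] by simp

lemma chain_eval_add: "chain_eval \<phi> (a + b) = chain_eval \<phi> a + chain_eval \<phi> b"
  using chain_eval_diff[of \<phi> a "- b"] by (simp add: chain_eval_minus)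

lemma chain_eval_sum: "chain_eval \<phi> (\<Sum>i\<in>I. f i) = (\<Sum>i\<in>I. chain_eval \<phi> (f i))"
  by (induction I rule: infinite_finite_induct) (auto simp: chain_eval_add)

text \<open>The reason for mod 2 values: signs of faces and of antipodal copies drop out, while the
  chains themselves stay integral.\<close>

lemma chain_eval_sign: "chain_eval \<phi> (frag_cmul ((-1) ^ k) a) = chain_eval \<phi> a"
  by (cases "even k") (auto simp: chain_eval_minus)

lemma chain_eval_cong:
  "(\<And>\<sigma>. \<sigma> \<in> Poly_Mapping.keys c \<Longrightarrow> \<phi> \<sigma> = \<psi> \<sigma>) \<Longrightarrow> chain_eval \<phi> c = chain_eval \<psi> c"
  by (simp add: chain_eval_def)

lemma chain_eval_add_fun: "chain_eval (\<lambda>\<sigma>. \<phi> \<sigma> + \<psi> \<sigma>) c = chain_eval \<phi> c + chain_eval \<psi> c"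
  unfolding chain_eval_def by (simp only: distrib_left sum.distrib)

lemma chain_eval_extend:
  "chain_eval \<phi> (frag_extend b c) = chain_eval (\<lambda>\<sigma>. chain_eval \<phi> (b \<sigma>)) c"
proof -
  have "Poly_Mapping.keys c \<subseteq> UNIV" by simp
  then show ?thesis
    by (induction c rule: frag_induction) (auto simp: frag_extend_diff chain_eval_diff)
qed

section \<open>Cup products of coboundaries, read off the vertex list\<close>

lemma bit_add_eq_0D: "a + b = 0 \<Longrightarrow> b = (a :: bit)"
  by (cases a; cases b) auto

lemma bit_self: "a + a = (0 :: bit)"
  by (cases a) auto

lemma bit_flip_flip: "(a + 1) + (b + 1) = a + (b :: bit)"
  by (cases a; cases b) auto

lemma bit_triangle: "(b + c) * x + ((a + c) * x + (a + b) * x) = (0 :: bit)"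
  by (cases a; cases b; cases c; cases x) auto

text \<open>The \<open>k\<close>-th coface map on vertex indices: \<open>v \<circ> skip k\<close>
  lists the vertices of the face opposite to vertex \<open>k\<close>.\<close>

definition skip :: "nat \<Rightarrow> nat \<Rightarrow> nat" where
  "skip k i = (if i < k then i else Suc i)"

text \<open>The cup product \<open>\<delta>\<theta>\<^sub>0 \<union> \<dots> \<union> \<delta>\<theta>\<^bsub>d-1\<^esub>\<close> of coboundaries of 0-cochains, on a simplex with vertices \<open>v\<close>.\<close>

definition alternation :: "(nat \<Rightarrow> 'a \<Rightarrow> bit) \<Rightarrow> nat \<Rightarrow> (nat \<Rightarrow> 'a) \<Rightarrow> bit" where
  "alternation \<theta> d v = (\<Prod>i<d. \<theta> i (v i) + \<theta> i (v (Suc i)))"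

lemma alternation_0 [simp]: "alternation \<theta> 0 v = 1"
  by (simp add: alternation_def)

lemma alternation_Suc:
  "alternation \<theta> (Suc d) v = (\<theta> 0 (v 0) + \<theta> 0 (v 1)) * alternation (\<theta> \<circ> Suc) d (v \<circ> Suc)"
  unfolding alternation_def prod.lessThan_Suc_shift by simp

lemma alternation_cong:
  "(\<And>i. i \<le> d \<Longrightarrow> v i = w i) \<Longrightarrow> alternation \<theta> d v = alternation \<theta> d w"
  unfolding alternation_def by (intro prod.cong) auto

lemma skip_0: "v \<circ> skip 0 = v \<circ> Suc"
  by (auto simp: skip_def)

lemma skip_Suc_Suc: "v \<circ> skip (Suc k) \<circ> Suc = v \<circ> Suc \<circ> skip k"
  by (auto simp: skip_def)

text \<open>A cup product of coboundaries is a cocycle. Faces with index at least 2 keep the edge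
  from \<open>v 0\<close> to \<open>v 1\<close>; by the induction hypothesis the remaining factors
  add up to the single term \<open>?A (v \<circ> Suc \<circ> Suc)\<close>. Together with faces 0 and
  1 this leaves the three edges of the triangle \<open>v 0\<close>, \<open>v 1\<close>,
  \<open>v 2\<close>, whose differences cancel mod 2.\<close>

lemma alternation_cocycle: "(\<Sum>k\<le>Suc d. alternation \<theta> d (v \<circ> skip k)) = 0"
proof (induction d arbitrary: \<theta> v)
  case 0
  then show ?case by simp
next
  case (Suc d)
  let ?A = "\<lambda>w. alternation (\<theta> \<circ> Suc) d w"
  have IH: "(\<Sum>k\<le>d. ?A (v \<circ> Suc \<circ> skip (Suc k))) = ?A (v \<circ> Suc \<circ> Suc)"
  proof -
    have "?A (v \<circ> Suc \<circ> skip 0) + (\<Sum>k\<le>d. ?A (v \<circ> Suc \<circ> skip (Suc k))) = 0"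
      using Suc[of "\<theta> \<circ> Suc" "v \<circ> Suc"] unfolding sum.atMost_Suc_shift .
    then show ?thesis unfolding skip_0
      by (rule bit_add_eq_0D)
  qed
  have k2: "alternation \<theta> (Suc d) (v \<circ> skip (Suc (Suc k)))
      = (\<theta> 0 (v 0) + \<theta> 0 (v 1)) * ?A (v \<circ> Suc \<circ> skip (Suc k))" for k
    unfolding alternation_Suc skip_Suc_Suc by (simp add: skip_def)
  have k1: "alternation \<theta> (Suc d) (v \<circ> skip (Suc 0))
      = (\<theta> 0 (v 0) + \<theta> 0 (v 2)) * ?A (v \<circ> Suc \<circ> Suc)"
    unfolding alternation_Suc skip_Suc_Suc skip_0 by (simp add: skip_def numeral_2_eq_2)
  have k0: "alternation \<theta> (Suc d) (v \<circ> skip 0)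
      = (\<theta> 0 (v 1) + \<theta> 0 (v 2)) * ?A (v \<circ> Suc \<circ> Suc)"
    unfolding alternation_Suc skip_0 by (simp add: numeral_2_eq_2)
  have "(\<Sum>k\<le>Suc (Suc d). alternation \<theta> (Suc d) (v \<circ> skip k))
     = (\<theta> 0 (v 1) + \<theta> 0 (v 2)) * ?A (v \<circ> Suc \<circ> Suc)
       + ((\<theta> 0 (v 0) + \<theta> 0 (v 2)) * ?A (v \<circ> Suc \<circ> Suc)
       + (\<Sum>k\<le>d. (\<theta> 0 (v 0) + \<theta> 0 (v 1)) * ?A (v \<circ> Suc \<circ> skip (Suc k))))"
    unfolding sum.atMost_Suc_shift k0 k1 k2 ..
  also have "\<dots> = 0"
    unfolding sum_distrib_left[symmetric] IH by (rule bit_triangle)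
  finally show ?case .
qed

text \<open>Leaving the first \<theta> undifferentiated gives a primitive of the whole product: face
  0 reads it at \<open>v 1\<close>, all other faces at \<open>v 0\<close>, and the cocycle relation
  for the other factors makes the two weights equal.\<close>

lemma alternation_coboundary:
  "(\<Sum>k\<le>Suc d. \<theta> 0 (v (skip k 0)) * alternation (\<theta> \<circ> Suc) d (v \<circ> skip k)) = alternation \<theta> (Suc d) v"
proof -
  let ?A = "\<lambda>w. alternation (\<theta> \<circ> Suc) d w"
  have c: "?A (v \<circ> Suc) + (\<Sum>k\<le>d. ?A (v \<circ> skip (Suc k))) = 0"
    using alternation_cocycle[where d=d and \<theta>="\<theta> \<circ> Suc" and v=v] unfolding sum.atMost_Suc_shift skip_0 .
  have s: "skip (Suc k) 0 = 0" "skip 0 0 = 1" for k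
    by (auto simp: skip_def)
  have "(\<Sum>k\<le>Suc d. \<theta> 0 (v (skip k 0)) * ?A (v \<circ> skip k))
      = \<theta> 0 (v 1) * ?A (v \<circ> Suc) + \<theta> 0 (v 0) * (\<Sum>k\<le>d. ?A (v \<circ> skip (Suc k)))"
    unfolding sum.atMost_Suc_shift skip_0 s sum_distrib_left ..
  also have "\<dots> = alternation \<theta> (Suc d) v"
    unfolding alternation_Suc bit_add_eq_0D[OF c] by (simp only: distrib_right add.commute)
  finally show ?thesis .
qed

section \<open>Vertices of singular simplices and evaluation on boundaries\<close>

abbreviation antipode :: "(nat \<Rightarrow> real) \<Rightarrow> nat \<Rightarrow> real" where
  "antipode \<equiv> \<lambda>x i. - x i"

definition vertices :: "((nat \<Rightarrow> real) \<Rightarrow> 'a) \<Rightarrow> nat \<Rightarrow> 'a" where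
  "vertices \<sigma> i = simplicial_vertex i \<sigma>"

lemma standard_vertex: "i \<le> p \<Longrightarrow> (\<lambda>j. if j = i then 1 else 0) \<in> standard_simplex p"
  by (auto simp: standard_simplex_def)

lemma vertices_simplex_map: "i \<le> p \<Longrightarrow> vertices (simplex_map p g \<sigma>) i = g (vertices \<sigma> i)"
  by (simp add: vertices_def simplicial_vertex_def simplex_map_def standard_vertex)

lemma vertices_singular_face:
  assumes "i \<le> d" "k \<le> Suc d"
  shows "vertices (singular_face (Suc d) k \<sigma>) i = vertices \<sigma> (skip k i)"
proof -
  have "simplical_face k (\<lambda>j. if j = i then 1 else 0) = (\<lambda>j. if j = skip k i then 1 else (0::real))"
    using assms by (auto simp: simplical_face_def skip_def fun_eq_iff)
  then show ?thesis
    using assms by (simp add: vertices_def simplicial_vertex_def singular_face_def standard_vertex)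
qed

lemma vertices_in_topspace:
  "singular_simplex p X \<sigma> \<Longrightarrow> i \<le> p \<Longrightarrow> vertices \<sigma> i \<in> topspace X"
  using standard_vertex[of i p] unfolding singular_simplex_def vertices_def simplicial_vertex_def
  by (auto simp: continuous_map_def topspace_standard_simplex)

text \<open>The discrete Stokes formula, applied to the primitive from
  \<open>alternation_coboundary\<close>.\<close>

lemma chain_eval_coboundary:
  "chain_eval (\<lambda>\<sigma>. \<theta> 0 (vertices \<sigma> 0) * alternation (\<theta> \<circ> Suc) d (vertices \<sigma>)) (chain_boundary (Suc d) c)
    = chain_eval (\<lambda>\<sigma>. alternation \<theta> (Suc d) (vertices \<sigma>)) c"
proof -
  have eq: "(\<Sum>k\<le>Suc d. \<theta> 0 (vertices (singular_face (Suc d) k \<sigma>) 0) *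
            alternation (\<theta> \<circ> Suc) d (vertices (singular_face (Suc d) k \<sigma>)))
      = alternation \<theta> (Suc d) (vertices \<sigma>)" for \<sigma> :: "(nat \<Rightarrow> real) \<Rightarrow> 'a"
    unfolding alternation_coboundary[symmetric]
    by (intro sum.cong refl arg_cong2[where f = "(*)"] alternation_cong)
       (auto simp: vertices_singular_face)
  show ?thesis
    unfolding chain_boundary_def
    by (simp only: nat.distinct if_False chain_eval_extend chain_eval_sum chain_eval_sign chain_eval_of eq)
qed

text \<open>A chain-level model of the equivariant cell structure of the sphere: \<open>H d\<close> plays the role of
  a \<open>d\<close>-dimensional hemisphere, bounded by two antipodal hemispheres of dimension \<open>d - 1\<close>.\<close>

definition hemisphere_chains :: "(nat \<Rightarrow> real) topology \<Rightarrow> nat \<Rightarrow> (nat \<Rightarrow> (nat \<Rightarrow> real) chain) \<Rightarrow> bool" where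
  "hemisphere_chains X n H \<longleftrightarrow>
     (\<forall>d\<le>n. singular_chain d X (H d)) \<and> (\<exists>\<sigma>. H 0 = frag_of \<sigma>) \<and>
     (\<forall>d<n. chain_boundary (Suc d) (H (Suc d)) = H d + frag_cmul ((-1) ^ Suc d) (chain_map d antipode (H d)))"

text \<open>Stokes moves the evaluation to the two antipodal hemispheres of the boundary. The
  antipode adds 1 to the undifferentiated factor and fixes all differences, so the two evaluations
  of the primitive cancel mod 2 and what remains is the product of the other factors on
  \<open>H d\<close>. The induction is over all \<theta> because the index shifts.\<close>

lemma chain_eval_hemisphere:
  assumes "hemisphere_chains X n H" "d \<le> n"
    and "\<And>i x. x \<in> topspace X \<Longrightarrow> \<theta> i (antipode x) = \<theta> i x + 1"
  shows "chain_eval (\<lambda>\<sigma>. alternation \<theta> d (vertices \<sigma>)) (H d) = 1"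
  using assms(2,3)
proof (induction d arbitrary: \<theta>)
  case 0
  then show ?case
    using assms(1) by (auto simp: hemisphere_chains_def)
next
  case (Suc d)
  let ?\<phi> = "\<lambda>\<sigma>. \<theta> 0 (vertices \<sigma> 0) * alternation (\<theta> \<circ> Suc) d (vertices \<sigma>)"
  have H: "singular_chain d X (H d)"
    using assms(1) Suc.prems(1) by (simp add: hemisphere_chains_def)
  have flip: "?\<phi> (simplex_map d antipode \<sigma>) = ?\<phi> \<sigma> + alternation (\<theta> \<circ> Suc) d (vertices \<sigma>)"
    if "\<sigma> \<in> Poly_Mapping.keys (H d)" for \<sigma>
  proof -
    have "singular_simplex d X \<sigma>"
      using H that unfolding singular_chain_def by blast
    then have v: "\<theta> j (vertices (simplex_map d antipode \<sigma>) i) = \<theta> j (vertices \<sigma> i) + 1" if "i \<le> d" for i j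
      unfolding vertices_simplex_map[OF that]
      by (intro Suc.prems(2) vertices_in_topspace[of d]) (use that in auto)
    have "alternation (\<theta> \<circ> Suc) d (vertices (simplex_map d antipode \<sigma>)) = alternation (\<theta> \<circ> Suc) d (vertices \<sigma>)"
      unfolding alternation_def by (intro prod.cong refl) (simp only: v lessThan_iff Suc_leI less_imp_le o_apply bit_flip_flip)
    then show ?thesis
      by (simp only: v[OF le0] distrib_right mult_1_left)
  qed
  have "chain_eval (\<lambda>\<sigma>. alternation \<theta> (Suc d) (vertices \<sigma>)) (H (Suc d))
      = chain_eval ?\<phi> (H d + frag_cmul ((-1) ^ Suc d) (chain_map d antipode (H d)))"
    using assms(1) Suc.prems by (simp add: hemisphere_chains_def flip: chain_eval_coboundary)
  also have "\<dots> = chain_eval ?\<phi> (H d) + chain_eval (\<lambda>\<sigma>. ?\<phi> (simplex_map d antipode \<sigma>)) (H d)"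
    unfolding chain_eval_add chain_eval_sign chain_map_def chain_eval_extend by simp
  also have "\<dots> = chain_eval ?\<phi> (H d)
      + (chain_eval ?\<phi> (H d) + chain_eval (\<lambda>\<sigma>. alternation (\<theta> \<circ> Suc) d (vertices \<sigma>)) (H d))"
    by (simp only: chain_eval_cong[OF flip] chain_eval_add_fun)
  also have "\<dots> = chain_eval (\<lambda>\<sigma>. alternation (\<theta> \<circ> Suc) d (vertices \<sigma>)) (H d)"
    by (simp only: add.assoc[symmetric] bit_self add_0_left)
  also have "\<dots> = 1"
    using Suc.prems by (intro Suc.IH) auto
  finally show ?case .
qed


text \<open>Reduced homology of the sphere vanishes below its dimension. In degree 0 the class is
  reduced only if its coefficients sum to zero, which \<open>aug\<close> expresses by the image in
  the one-point space.\<close>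

lemma nsphere_cycle_is_boundary:
  assumes c: "singular_chain p (nsphere n) c" "chain_boundary p c = 0"
    and "p < n"
    and aug: "p = 0 \<Longrightarrow> chain_map 0 (\<lambda>x. ()) c = 0"
  obtains b where "singular_chain (Suc p) (nsphere n) b" "chain_boundary (Suc p) b = c"
proof -
  let ?X = "nsphere n" and ?Y = "discrete_topology {()}"
  let ?h = "hom_induced (int p) ?X {} ?Y {} (\<lambda>x. ())"
  have cyc: "singular_relcycle p ?X {} c"
    using c by (simp add: singular_cycle)
  have carr: "homologous_rel_set p ?X {} c \<in> carrier (homology_group (int p) ?X)"
    using cyc by (auto simp: carrier_relative_homology_group)
  have "homologous_rel_set p ?X {} c \<in> carrier (reduced_homology_group (int p) ?X)"
  proof (cases "p = 0")
    case True
    have "?h (homologous_rel_set p ?X {} c) = homologous_rel_set p ?Y {} (chain_map p (\<lambda>x. ()) c)"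
      using cyc by (intro hom_induced_chain_map) (auto simp: continuous_map_const)
    also have "\<dots> = singular_relboundary_set p ?Y {}"
      using aug True by (simp add: homologous_rel_set_eq_relboundary)
    also have "\<dots> = \<one>\<^bsub>homology_group (int p) ?Y\<^esub>"
      by (rule one_relative_homology_group[symmetric])
    finally show ?thesis
      using carr by (simp add: carrier_reduced_homology_group kernel_def)
  next
    case False
    then show ?thesis
      using carr by (simp add: un_reduced_homology_group)
  qed
  moreover have "trivial_group (reduced_homology_group (int p) ?X)"
    using \<open>p < n\<close> by (simp add: trivial_reduced_homology_group_nsphere)
  ultimately have "homologous_rel_set p ?X {} c = \<one>\<^bsub>homology_group (int p) ?X\<^esub>"
    by (simp add: trivial_group_def one_reduced_homology_group)
  then have "singular_relboundary p ?X {} c"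
    by (simp add: one_relative_homology_group homologous_rel_set_eq_relboundary)
  then show ?thesis
    using that by (auto simp: singular_boundary)
qed

lemma continuous_map_nsphere_antipode: "continuous_map (nsphere n) (nsphere n) antipode"
  by (auto simp: nsphere continuous_map_in_subtopology continuous_map_componentwise_UNIV
      intro!: continuous_map_from_subtopology continuous_map_product_projection continuous_intros)

lemma chain_map_antipode_antipode:
  "singular_chain d X c \<Longrightarrow> chain_map d antipode (chain_map d antipode c) = c"
proof -
  assume c: "singular_chain d X c"
  have "chain_map d antipode (chain_map d antipode c) = chain_map d (antipode \<circ> antipode) c"
    by (simp add: chain_map_compose)
  also have "\<dots> = c"
    by (rule chain_map_id_gen[OF c]) auto
  finally show ?thesis .
qed

text \<open>Since the antipode is an involution, it multiplies the boundary of \<open>H m\<close> by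
  \<open>(-1) ^ m\<close>; the opposite sign in \<open>?c\<close> makes \<open>?c\<close> a cycle,
  and in degree 0 gives it augmentation zero. Below the top dimension it therefore bounds, and a
  filling is the next hemisphere.\<close>

lemma hemisphere_chains_exist: "m \<le> n \<Longrightarrow> \<exists>H. hemisphere_chains (nsphere n) m H"
proof (induction m)
  case 0
  let ?e = "\<lambda>k. if k = 0 then 1 else (0::real)"
  let ?s = "restrict (\<lambda>x. ?e) (standard_simplex 0)"
  have "singular_simplex 0 (nsphere n) ?s"
    using in_topspace_nsphere[of n] by (simp add: singular_simplex_def)
  then have "hemisphere_chains (nsphere n) 0 (\<lambda>d. frag_of ?s)"
    by (auto simp: hemisphere_chains_def singular_chain_of)
  then show ?case by blast
next
  case (Suc m)
  then obtain H where H: "hemisphere_chains (nsphere n) m H" by auto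
  let ?c = "H m + frag_cmul ((-1) ^ Suc m) (chain_map m antipode (H m))"
  have Hm: "singular_chain m (nsphere n) (H m)"
    using H by (simp add: hemisphere_chains_def)
  have c: "singular_chain m (nsphere n) ?c"
    by (intro singular_chain_add singular_chain_cmul singular_chain_chain_map[of _ "nsphere n"] Hm
        continuous_map_nsphere_antipode)
  have bd: "chain_boundary m ?c = 0"
  proof (cases m)
    case (Suc k)
    have Hk: "singular_chain k (nsphere n) (H k)"
      and b: "chain_boundary m (H m) = H k + frag_cmul ((-1) ^ m) (chain_map k antipode (H k))"
      using H by (auto simp: hemisphere_chains_def Suc)
    have "chain_boundary m (chain_map m antipode (H m))
        = chain_map k antipode (chain_boundary m (H m))"
      using chain_boundary_chain_map[OF Hm] by (simp add: Suc)
    also have "\<dots> = chain_map k antipode (H k) + frag_cmul ((-1) ^ m) (H k)"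
      by (simp only: b chain_map_add chain_map_cmul chain_map_antipode_antipode[OF Hk])
    finally show ?thesis
      by (cases "even m") (simp_all add: chain_boundary_add chain_boundary_diff b)
  qed (simp add: chain_boundary_def)
  have aug: "chain_map 0 (\<lambda>x. ()) ?c = 0" if "m = 0"
  proof -
    have "chain_map 0 (\<lambda>x. ()) (chain_map 0 antipode (H 0)) = chain_map 0 (\<lambda>x. ()) (H 0)"
      unfolding o_apply[symmetric, of "chain_map 0 (\<lambda>x. ())"] chain_map_compose[symmetric]
      by (simp add: comp_def)
    then show ?thesis
      using that by (simp add: chain_map_diff)
  qed
  obtain b where b: "singular_chain (Suc m) (nsphere n) b" "chain_boundary (Suc m) b = ?c"
    using nsphere_cycle_is_boundary[OF c bd _ aug] Suc.prems by auto
  have "hemisphere_chains (nsphere n) (Suc m) (H(Suc m := b))"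
    using H b by (auto simp: hemisphere_chains_def le_Suc_eq less_Suc_eq)
  then show ?case by blast
qed

section \<open>Iterated barycentric subdivision of hemispheres\<close>

lemma singular_chain_subdivision_power:
  "singular_chain p X c \<Longrightarrow> singular_chain p X ((singular_subdivision p ^^ N) c)"
  by (induction N) (auto intro: singular_chain_singular_subdivision)

lemma chain_boundary_subdivision_power:
  "singular_chain (Suc p) X c \<Longrightarrow>
    chain_boundary (Suc p) ((singular_subdivision (Suc p) ^^ N) c)
      = (singular_subdivision p ^^ N) (chain_boundary (Suc p) c)"
  by (induction N)
     (auto simp: chain_boundary_singular_subdivision[OF singular_chain_subdivision_power])

lemma naturality_subdivision_power:
  "singular_chain p X c \<Longrightarrow>
    (singular_subdivision p ^^ N) (chain_map p g c) = chain_map p g ((singular_subdivision p ^^ N) c)"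
  by (induction N) (auto simp: naturality_singular_subdivision[OF singular_chain_subdivision_power])

lemma singular_subdivision_power_add:
  "(singular_subdivision p ^^ N) (a + b) = (singular_subdivision p ^^ N) a + (singular_subdivision p ^^ N) b"
  by (induction N) (auto simp: singular_subdivision_add)

lemma singular_subdivision_power_sign:
  "(singular_subdivision p ^^ N) (frag_cmul ((-1) ^ k) a) = frag_cmul ((-1) ^ k) ((singular_subdivision p ^^ N) a)"
  using singular_subdivision_power_diff[of N p 0 a] by (cases "even k") auto

text \<open>Subdivision commutes with boundaries and with the antipode and fixes 0-chains, so the
  value 1 of \<open>chain_eval_hemisphere\<close> remains available on arbitrarily fine
  chains.\<close>

lemma hemisphere_chains_subdivision:
  assumes "hemisphere_chains X n H"
  shows "hemisphere_chains X n (\<lambda>d. (singular_subdivision d ^^ N) (H d))"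
  unfolding hemisphere_chains_def
proof (intro conjI allI impI)
  fix d assume "d \<le> n"
  then show "singular_chain d X ((singular_subdivision d ^^ N) (H d))"
    using assms by (auto simp: hemisphere_chains_def intro: singular_chain_subdivision_power)
next
  have "singular_chain 0 X (H 0)"
    using assms by (auto simp: hemisphere_chains_def)
  then have "(singular_subdivision 0 ^^ N) (H 0) = H 0"
    by (induction N) (auto simp: singular_subdivision_zero[of X])
  then show "\<exists>\<sigma>. (singular_subdivision 0 ^^ N) (H 0) = frag_of \<sigma>"
    using assms by (auto simp: hemisphere_chains_def)
next
  fix d assume "d < n"
  then have H: "singular_chain d X (H d)" "singular_chain (Suc d) X (H (Suc d))"
    and b: "chain_boundary (Suc d) (H (Suc d)) = H d + frag_cmul ((-1) ^ Suc d) (chain_map d antipode (H d))"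
    using assms by (auto simp: hemisphere_chains_def simp del: power_Suc)
  show "chain_boundary (Suc d) ((singular_subdivision (Suc d) ^^ N) (H (Suc d)))
      = (singular_subdivision d ^^ N) (H d)
        + frag_cmul ((-1) ^ Suc d) (chain_map d antipode ((singular_subdivision d ^^ N) (H d)))"
    by (simp only: chain_boundary_subdivision_power[OF H(2)] b singular_subdivision_power_add
        singular_subdivision_power_sign naturality_subdivision_power[OF H(1)])
qed

text \<open>A rule that picks exactly one of \<open>x\<close> and \<open>antipode x\<close> when
  \<open>x\<close> is not zero; it serves as the fallback value of \<theta> and selects one critical
  point from each pair.\<close>

definition leading_pos :: "(nat \<Rightarrow> real) \<Rightarrow> bool" where
  "leading_pos x \<longleftrightarrow> (\<exists>i. x i > 0 \<and> (\<forall>j<i. x j = 0))"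

lemma leading_pos_antipode:
  assumes "x \<noteq> (\<lambda>_. 0)"
  shows "leading_pos (antipode x) \<longleftrightarrow> \<not> leading_pos x"
proof -
  define i where "i = (LEAST i. x i \<noteq> 0)"
  have ex: "\<exists>i. x i \<noteq> 0"
    using assms by auto
  have i: "x i \<noteq> 0" "\<forall>j<i. x j = 0"
    unfolding i_def using LeastI_ex[OF ex] not_less_Least by blast+
  have "leading_pos y \<longleftrightarrow> y i > 0" if "y i \<noteq> 0" "\<forall>j<i. y j = 0" for y
  proof
    assume "leading_pos y"
    then obtain k where k: "y k > 0" "\<forall>j<k. y j = 0"
      by (auto simp: leading_pos_def)
    then have "k = i"
      using that by (cases k i rule: linorder_cases) auto
    with k show "y i > 0" by simp
  qed (use that in \<open>auto simp: leading_pos_def\<close>)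
  from this[of x] this[of "antipode x"] show ?thesis
    using i by auto
qed

text \<open>After subdivision every simplex lies in some \<open>U i\<close> or in its antipodal
  copy. There \<theta> of index \<open>i\<close> is constant, so the factor of index
  \<open>i\<close> vanishes and the product evaluates to 0 instead of 1. The bound on
  \<open>m\<close> is sharp: the n + 1 half spheres where a coordinate is positive cover, together
  with their antipodes.\<close>

theorem lusternik_schnirelmann:
  assumes "m \<le> n"
    and op: "\<And>i. i < m \<Longrightarrow> openin (nsphere n) (U i)"
    and disj: "\<And>i x. i < m \<Longrightarrow> x \<in> U i \<Longrightarrow> antipode x \<notin> U i"
    and cover: "\<And>x. x \<in> topspace (nsphere n) \<Longrightarrow> \<exists>i<m. x \<in> U i \<or> antipode x \<in> U i"
  shows False
proof -
  let ?X = "nsphere n"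
  define U' where "U' i = {x \<in> topspace ?X. antipode x \<in> U i}" for i
  \<comment> \<open>The first two cases cannot overlap after applying the antipode, by
    \<open>disj\<close>. Points outside both sets only need some value that flips under the
    antipode.\<close>
  define \<theta> :: "nat \<Rightarrow> (nat \<Rightarrow> real) \<Rightarrow> bit" where
    "\<theta> i x = (if i < m \<and> x \<in> U i then 1 else if i < m \<and> antipode x \<in> U i then 0
             else if leading_pos x then 1 else 0)" for i x
  have \<theta>: "\<theta> i (antipode x) = \<theta> i x + 1" if "x \<in> topspace ?X" for i x
  proof -
    have "x \<noteq> (\<lambda>_. 0)"
      using that by (auto simp: nsphere)
    from leading_pos_antipode[OF this] show ?thesis
      using disj[of i x] by (auto simp: \<theta>_def)
  qed
  obtain H where H: "hemisphere_chains ?X m H"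
    using hemisphere_chains_exist[OF \<open>m \<le> n\<close>] by blast
  then have Hm: "singular_chain m ?X (H m)"
    by (auto simp: hemisphere_chains_def)
  have "openin ?X V" if "V \<in> U ` {..<m} \<union> U' ` {..<m}" for V
    using that op openin_continuous_map_preimage[OF continuous_map_nsphere_antipode]
    by (auto simp: U'_def)
  moreover have "topspace ?X \<subseteq> \<Union> (U ` {..<m} \<union> U' ` {..<m})"
    using cover by (force simp: U'_def)
  ultimately obtain N where
    N: "\<And>\<sigma>. \<sigma> \<in> Poly_Mapping.keys ((singular_subdivision m ^^ N) (H m)) \<Longrightarrow>
          \<exists>V \<in> U ` {..<m} \<union> U' ` {..<m}. \<sigma> \<in> standard_simplex m \<rightarrow> V"
    using sufficient_iterated_singular_subdivision_exists[OF _ _ Hm] by (metis order_refl)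
  have "chain_eval (\<lambda>\<sigma>. alternation \<theta> m (vertices \<sigma>)) ((singular_subdivision m ^^ N) (H m)) = 1"
    using chain_eval_hemisphere[OF hemisphere_chains_subdivision[OF H] order_refl, of \<theta> N] \<theta> by blast
  moreover have "chain_eval (\<lambda>\<sigma>. alternation \<theta> m (vertices \<sigma>)) ((singular_subdivision m ^^ N) (H m)) = chain_eval (\<lambda>\<sigma>. 0) ((singular_subdivision m ^^ N) (H m))"
  proof (rule chain_eval_cong)
    fix \<sigma> assume "\<sigma> \<in> Poly_Mapping.keys ((singular_subdivision m ^^ N) (H m))"
    from N[OF this] obtain i where i: "i < m" "\<sigma> \<in> standard_simplex m \<rightarrow> U i \<or> \<sigma> \<in> standard_simplex m \<rightarrow> U' i"
      by auto
    have "\<theta> i (vertices \<sigma> j) = (if \<sigma> \<in> standard_simplex m \<rightarrow> U i then 1 else 0)" if "j \<le> m" for j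
    proof -
      have "\<sigma> \<in> standard_simplex m \<rightarrow> V \<Longrightarrow> vertices \<sigma> j \<in> V" for V
        using standard_vertex[OF that] by (auto simp: vertices_def simplicial_vertex_def)
      then show ?thesis
        using i disj[OF i(1), of "vertices \<sigma> j"] by (auto simp: \<theta>_def U'_def)
    qed
    then have "\<theta> i (vertices \<sigma> i) + \<theta> i (vertices \<sigma> (Suc i)) = 0"
      using i(1) by (simp only: Suc_leI less_imp_le bit_self)
    then show "alternation \<theta> m (vertices \<sigma>) = 0"
      unfolding alternation_def using i(1) by (intro prod_zero) auto
  qed
  ultimately show False
    by (simp add: chain_eval_def)
qed

section \<open>Critical points of even functionals\<close>

text \<open>R^N is kept inside \<open>nat \<Rightarrow> real\<close> because
  \<open>nsphere (N - 1)\<close> lives there. The norm below sees only the first \<open>N\<close>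
  coordinates, hence is a norm only on this set.\<close>

definition coord_space :: "nat \<Rightarrow> (nat \<Rightarrow> real) set" where
  "coord_space N = {x. \<forall>i\<ge>N. x i = 0}"

definition enorm :: "nat \<Rightarrow> (nat \<Rightarrow> real) \<Rightarrow> real" where
  "enorm N x = L2_set x {..<N}"

definition edist :: "nat \<Rightarrow> (nat \<Rightarrow> real) \<Rightarrow> (nat \<Rightarrow> real) \<Rightarrow> real" where
  "edist N x y = enorm N (\<lambda>i. x i - y i)"

definition einner :: "nat \<Rightarrow> (nat \<Rightarrow> real) \<Rightarrow> (nat \<Rightarrow> real) \<Rightarrow> real" where
  "einner N x y = (\<Sum>i<N. x i * y i)"

lemma enorm_nonneg [simp]: "0 \<le> enorm N x"
  by (simp add: enorm_def)

lemma enorm_antipode [simp]: "enorm N (antipode x) = enorm N x"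
  by (simp add: enorm_def L2_set_def)

lemma enorm_scale: "enorm N (\<lambda>i. c * x i) = \<bar>c\<bar> * enorm N x"
  by (simp add: enorm_def L2_set_def power_mult_distrib real_sqrt_mult flip: sum_distrib_left)

lemma enorm_power2: "(enorm N x)\<^sup>2 = (\<Sum>i<N. (x i)\<^sup>2)"
  by (simp add: enorm_def L2_set_def sum_nonneg)

lemma enorm_eq_0_iff: "x \<in> coord_space N \<Longrightarrow> enorm N x = 0 \<longleftrightarrow> x = (\<lambda>_. 0)"
  unfolding enorm_def coord_space_def by (simp add: L2_set_eq_0_iff fun_eq_iff) (meson lessThan_iff not_le)

lemma enorm_triangle: "enorm N (\<lambda>i. x i + y i) \<le> enorm N x + enorm N y"
  unfolding enorm_def by (rule L2_set_triangle_ineq)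

lemma edist_triangle: "edist N x z \<le> edist N x y + edist N y z"
  using enorm_triangle[of N "\<lambda>i. x i - y i" "\<lambda>i. y i - z i"] by (simp add: edist_def)

lemma edist_commute: "edist N x y = edist N y x"
  using enorm_antipode[of N "\<lambda>i. x i - y i"] by (simp add: edist_def)

lemma edist_self [simp]: "edist N x x = 0"
  by (simp add: edist_def enorm_def L2_set_def)

lemma coord_le_enorm: "i < N \<Longrightarrow> \<bar>x i\<bar> \<le> enorm N x"
proof -
  assume "i < N"
  then have "(x i)\<^sup>2 \<le> (enorm N x)\<^sup>2"
    unfolding enorm_power2 by (intro member_le_sum[of i _ "\<lambda>i. (x i)\<^sup>2"]) auto
  then show ?thesis
    by (metis abs_le_square_iff abs_of_nonneg enorm_nonneg)
qed

lemma antipode_in_coord_space: "antipode x \<in> coord_space N \<longleftrightarrow> x \<in> coord_space N"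
  by (auto simp: coord_space_def)

section \<open>Continuity and compactness in the product topology\<close>

lemma continuous_on_coord [continuous_intros]: "continuous_on S (\<lambda>x::nat \<Rightarrow> real. x i)"
  by (rule continuous_on_product_coordinates[THEN continuous_on_subset]) auto

lemma continuous_on_enorm [continuous_intros]:
  "(\<And>i. i < N \<Longrightarrow> continuous_on S (\<lambda>x. f x i)) \<Longrightarrow> continuous_on S (\<lambda>x. enorm N (f x))"
  unfolding enorm_def L2_set_def by (intro continuous_intros) auto

lemma continuous_on_edist [continuous_intros]: "continuous_on S (\<lambda>x. edist N x k)"
  unfolding edist_def by (intro continuous_intros)

text \<open>A closed subset of a product of compact intervals, with a single point in every
  coordinate from \<open>N\<close> on.\<close>

lemma compact_enorm_ball: "compact {x \<in> coord_space N. enorm N x \<le> R}"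
proof -
  let ?B = "\<lambda>i. if i < N then {-R..R} else {0::real}"
  have "compactin (product_topology (\<lambda>i. euclidean) UNIV) (PiE UNIV ?B)"
    by (subst compactin_PiE) (auto simp: compactin_euclidean_iff)
  then have c: "compact (PiE UNIV ?B)"
    by (simp add: euclidean_product_topology flip: compactin_euclidean_iff)
  have cl: "closed {x. enorm N x \<le> R}"
    by (intro closed_Collect_le continuous_intros)
  have "{x \<in> coord_space N. enorm N x \<le> R} = PiE UNIV ?B \<inter> {x. enorm N x \<le> R}"
  proof (intro Set.set_eqI iffI)
    fix x assume x: "x \<in> {x \<in> coord_space N. enorm N x \<le> R}"
    have "\<bar>x i\<bar> \<le> R" if "i < N" for i
      using coord_le_enorm[OF that, of x] x by simp
    then show "x \<in> PiE UNIV ?B \<inter> {x. enorm N x \<le> R}"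
      using x by (auto simp: coord_space_def PiE_iff abs_le_iff) (metis minus_le_iff)
  next
    fix x assume x: "x \<in> PiE UNIV ?B \<inter> {x. enorm N x \<le> R}"
    then have "x i \<in> ?B i" for i by (auto simp: PiE_iff)
    then have "x i = 0" if "i \<ge> N" for i
      using that by (metis not_le singletonD)
    then show "x \<in> {x \<in> coord_space N. enorm N x \<le> R}"
      using x by (simp add: coord_space_def)
  qed
  then show ?thesis
    using c cl by (simp add: compact_Int_closed)
qed

lemma finite_positive_lower_bound:
  fixes D :: "real set"
  assumes "finite D" "\<forall>d\<in>D. 0 < d"
  shows "\<exists>e>0. \<forall>d\<in>D. e \<le> d"
  using assms by (intro exI[of _ "Min (insert 1 D)"]) auto

text \<open>The gradient enters only through a first-order expansion that is uniform on balls, which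
  holds for continuous nonlinearities. Boundedness is required only where \<open>J\<close> is
  negative, so compactness is available at levels below zero.\<close>

locale even_functional =
  fixes N :: nat and J :: "(nat \<Rightarrow> real) \<Rightarrow> real" and g :: "(nat \<Rightarrow> real) \<Rightarrow> nat \<Rightarrow> real" and r\<^sub>0 :: real
  assumes N_pos: "N \<ge> 1"
    and J_even: "x \<in> coord_space N \<Longrightarrow> J (antipode x) = J x"
    and J_0: "J (\<lambda>_. 0) = 0"
    and g_odd: "x \<in> coord_space N \<Longrightarrow> g (antipode x) = antipode (g x)"
    and g_coord_space: "g x \<in> coord_space N"
    and J_cont: "continuous_on UNIV J"
    and g_cont: "continuous_on UNIV (\<lambda>x. g x i)"
    and gradient: "0 < \<omega> \<Longrightarrow> \<exists>\<delta>>0. \<forall>x\<in>coord_space N. \<forall>v\<in>coord_space N. enorm N x \<le> R \<longrightarrow> enorm N v \<le> \<delta>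
        \<longrightarrow> \<bar>J (\<lambda>i. x i + v i) - J x - einner N (g x) v\<bar> \<le> \<omega> * enorm N v"
    and bounded_sublevel: "\<exists>R. \<forall>x\<in>coord_space N. J x < 0 \<longrightarrow> enorm N x \<le> R"
    and r\<^sub>0_pos: "0 < r\<^sub>0"
    and J_sphere: "x \<in> coord_space N \<Longrightarrow> enorm N x = r\<^sub>0 \<Longrightarrow> J x < 0"
begin

definition sublevel :: "real \<Rightarrow> (nat \<Rightarrow> real) set" where
  "sublevel c = {x \<in> coord_space N. J x \<le> c}"

definition crit :: "(nat \<Rightarrow> real) set" where
  "crit = {x \<in> coord_space N. g x = (\<lambda>_. 0) \<and> J x < 0}"

section \<open>Compactness of sublevels and discrete descent\<close>

lemma compact_sublevel: "c < 0 \<Longrightarrow> compact (sublevel c)"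
proof -
  assume "c < 0"
  obtain R where R: "\<forall>x\<in>coord_space N. J x < 0 \<longrightarrow> enorm N x \<le> R"
    using bounded_sublevel by blast
  have "sublevel c = {x \<in> coord_space N. enorm N x \<le> R} \<inter> {x. J x \<le> c}"
    using R \<open>c < 0\<close> by (auto simp: sublevel_def)
  moreover have "closed {x. J x \<le> c}"
    by (intro closed_Collect_le J_cont continuous_intros)
  ultimately show ?thesis
    using compact_enorm_ball by (simp add: compact_Int_closed)
qed

lemma continuous_on_enorm_g: "continuous_on S (\<lambda>x. enorm N (g x))"
  by (intro continuous_on_enorm continuous_on_subset[OF g_cont]) auto

text \<open>Compactness does the work of a Palais-Smale condition: the norm of the gradient attains
  its minimum on the closed piece, and a zero there would be a critical point.\<close>

lemma gradient_lower_bound: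
  assumes "c < 0" "closed C" "sublevel c \<inter> C \<inter> crit = {}"
  shows "\<exists>G>0. \<forall>x\<in>sublevel c \<inter> C. G \<le> enorm N (g x)"
proof (cases "sublevel c \<inter> C = {}")
  case True
  then show ?thesis by (intro exI[of _ 1]) auto
next
  case False
  have "compact (sublevel c \<inter> C)"
    using assms compact_sublevel by (simp add: compact_Int_closed)
  from continuous_attains_inf[OF this False continuous_on_enorm_g]
  obtain y where y: "y \<in> sublevel c \<inter> C" "\<forall>x\<in>sublevel c \<inter> C. enorm N (g y) \<le> enorm N (g x)"
    by blast
  then have "g y \<noteq> (\<lambda>_. 0)"
    using assms by (auto simp: crit_def sublevel_def)
  then have "0 < enorm N (g y)"
    using enorm_eq_0_iff[OF g_coord_space[of y]] enorm_nonneg[of N "g y"] by linarith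
  then show ?thesis
    using y by blast
qed

lemma antipode_in_crit: "x \<in> crit \<Longrightarrow> antipode x \<in> crit"
  by (auto simp: crit_def antipode_in_coord_space J_even g_odd)

text \<open>One truncated gradient step. It leaves points with \<open>enorm N (g x) \<le> \<epsilon>\<close> fixed, so that the
  first-order estimate is only used where it controls the error.\<close>

lemma descent_step:
  assumes "c < 0" "0 < \<epsilon>" "0 < s"
  obtains h \<kappa> where "0 < \<kappa>" "continuous_on UNIV h"
    "\<And>x. x \<in> coord_space N \<Longrightarrow> h (antipode x) = antipode (h x)"
    "\<And>x. x \<in> coord_space N \<Longrightarrow> h x \<in> coord_space N"
    "\<And>x. x \<in> sublevel c \<Longrightarrow> J (h x) \<le> J x - enorm N (g x) * edist N (h x) x / 2"
    "\<And>x. x \<in> sublevel c \<Longrightarrow> edist N (h x) x \<le> s"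
    "\<And>x. x \<in> sublevel c \<Longrightarrow> 2 * \<epsilon> \<le> enorm N (g x) \<Longrightarrow> J (h x) \<le> J x - \<kappa>"
proof -
  obtain R where R: "\<forall>x\<in>coord_space N. J x < 0 \<longrightarrow> enorm N x \<le> R"
    using bounded_sublevel by blast
  have "compact ((\<lambda>x. enorm N (g x)) ` sublevel c)"
    by (intro compact_continuous_image continuous_on_enorm_g compact_sublevel assms)
  then obtain L where L: "0 < L" "\<And>x. x \<in> sublevel c \<Longrightarrow> enorm N (g x) \<le> L"
    using bounded_pos[THEN iffD1, OF compact_imp_bounded] by force
  obtain \<delta> where \<delta>: "\<delta> > 0" "\<And>x v. \<lbrakk>x \<in> coord_space N; v \<in> coord_space N; enorm N x \<le> R; enorm N v \<le> \<delta>\<rbrakk>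
      \<Longrightarrow> \<bar>J (\<lambda>i. x i + v i) - J x - einner N (g x) v\<bar> \<le> \<epsilon> / 2 * enorm N v"
    using gradient[of "\<epsilon> / 2" R] \<open>0 < \<epsilon>\<close> by auto
  \<comment> \<open>A step moves by at most \<open>\<tau> * L\<^sup>2\<close>, so this choice keeps
    it both within the range \<delta> of the expansion and below the prescribed length
    \<open>s\<close>.\<close>
  define \<tau> where "\<tau> = min \<delta> s / L\<^sup>2"
  have \<tau>: "0 < \<tau>" "\<tau> * L\<^sup>2 \<le> \<delta>" "\<tau> * L\<^sup>2 \<le> s"
    using L \<delta> assms by (auto simp: \<tau>_def)
  define t where "t x = \<tau> * max 0 (enorm N (g x) - \<epsilon>)" for x
  have t0: "0 \<le> t x" for x
    using \<tau> by (simp add: t_def)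
  define h where "h x = (\<lambda>i. x i - t x * g x i)" for x
  have dist: "edist N (h x) x = t x * enorm N (g x)" for x
  proof -
    have "edist N (h x) x = enorm N (\<lambda>i. (- t x) * g x i)"
      by (simp add: edist_def h_def)
    then show ?thesis
      using t0[of x] by (simp only: enorm_scale) simp
  qed
  have cont_h: "continuous_on UNIV h"
  proof (rule continuous_on_coordinatewise_then_product)
    show "continuous_on UNIV (\<lambda>x. h x i)" for i
      unfolding h_def t_def
      by (intro continuous_intros continuous_on_enorm_g g_cont)
  qed
  have odd_h: "h (antipode x) = antipode (h x)" if "x \<in> coord_space N" for x
    using that by (auto simp: h_def t_def g_odd)
  have h_coord: "h x \<in> coord_space N" if "x \<in> coord_space N" for x
    using that g_coord_space[of x] by (auto simp: h_def coord_space_def)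
  have small: "edist N (h x) x \<le> \<tau> * L\<^sup>2" if "x \<in> sublevel c" for x
  proof -
    have "max 0 (enorm N (g x) - \<epsilon>) * enorm N (g x) \<le> L * L"
      using L(2)[OF that] L(1) \<open>0 < \<epsilon>\<close> by (intro mult_mono) auto
    then show ?thesis
      using \<tau> by (simp add: dist t_def power2_eq_square mult.assoc)
  qed
  have desc: "J (h x) \<le> J x - enorm N (g x) * edist N (h x) x / 2" if x: "x \<in> sublevel c" for x
  proof -
    define v where "v = (\<lambda>i. (- t x) * g x i)"
    have v: "enorm N v = edist N (h x) x" "h x = (\<lambda>i. x i + v i)"
      by (auto simp: edist_def h_def v_def)
    have xs: "x \<in> coord_space N" "v \<in> coord_space N" "enorm N x \<le> R"
      using x g_coord_space[of x] R \<open>c < 0\<close> by (auto simp: sublevel_def v_def coord_space_def)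
    have vd: "enorm N v \<le> \<delta>"
      using small[OF x] \<tau> v(1) by simp
    have ip: "einner N (g x) v = - (t x * (enorm N (g x))\<^sup>2)"
      unfolding einner_def v_def enorm_power2 sum_distrib_left sum_negf[symmetric]
      by (intro sum.cong) (auto simp: power2_eq_square)
    have 1: "J (h x) \<le> J x - t x * (enorm N (g x))\<^sup>2 + \<epsilon> / 2 * (t x * enorm N (g x))"
      using \<delta>(2)[OF xs vd] unfolding v(2)[symmetric] ip v(1) dist by linarith
    \<comment> \<open>Effect of the truncation: either the point does not move, or the gradient
      exceeds \<epsilon> and the expansion error is at most half of the linear gain.\<close>
    have "t x * (\<epsilon> * enorm N (g x)) \<le> t x * (enorm N (g x))\<^sup>2"
    proof (cases "enorm N (g x) \<le> \<epsilon>")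
      case False
      then show ?thesis
        using t0[of x] by (intro mult_left_mono) (auto simp: power2_eq_square intro: mult_right_mono)
    qed (simp add: t_def)
    then show ?thesis
      using 1 unfolding dist by (simp add: power2_eq_square algebra_simps)
  qed
  \<comment> \<open>Here \<open>t x\<close> is at least \<open>\<tau> * \<epsilon>\<close> and the
    squared gradient at least \<open>4 * \<epsilon>\<^sup>2\<close>; half their product is the
    drop.\<close>
  have desc': "J (h x) \<le> J x - 2 * \<tau> * \<epsilon> ^ 3" if x: "x \<in> sublevel c" "2 * \<epsilon> \<le> enorm N (g x)" for x
  proof -
    have "\<tau> * \<epsilon> \<le> t x"
      using x \<tau> \<open>0 < \<epsilon>\<close> by (auto simp: t_def)
    then have "\<tau> * \<epsilon> * (2 * \<epsilon>)\<^sup>2 \<le> t x * (enorm N (g x))\<^sup>2"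
      using x t0[of x] \<open>0 < \<epsilon>\<close> by (intro mult_mono power_mono) auto
    then show ?thesis
      using desc[OF x(1)] unfolding dist by (simp add: power2_eq_square power3_eq_cube algebra_simps)
  qed
  show thesis
    using that[of "2 * \<tau> * \<epsilon> ^ 3" h] \<tau> \<open>0 < \<epsilon>\<close> cont_h odd_h h_coord desc desc' small by fastforce
qed


lemma descent_iterate:
  assumes "\<And>x. x \<in> coord_space N \<Longrightarrow> h x \<in> coord_space N"
    and "\<And>x. x \<in> sublevel c \<Longrightarrow> J (h x) \<le> J x"
    and "x \<in> sublevel c"
  shows "(h ^^ n) x \<in> sublevel c"
proof (induction n)
  case (Suc n)
  then have "J (h ((h ^^ n) x)) \<le> J ((h ^^ n) x)" by (rule assms(2))
  with Suc show ?case by (auto simp: sublevel_def assms(1))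
qed (simp add: assms(3))

text \<open>On the compact sublevel \<open>J\<close> is bounded, so no orbit can afford more than a
  fixed number of drops by \<kappa>.\<close>

lemma visits_critical_ball:
  assumes "c < 0" "0 < \<kappa>"
    and h: "\<And>x. x \<in> coord_space N \<Longrightarrow> h x \<in> coord_space N"
      "\<And>x. x \<in> sublevel c \<Longrightarrow> J (h x) \<le> J x"
      "\<And>x. x \<in> sublevel c \<Longrightarrow> x \<notin> B \<Longrightarrow> J (h x) \<le> J x - \<kappa>"
  shows "\<exists>n. \<forall>x\<in>sublevel c. \<exists>j\<le>n. (h ^^ j) x \<in> B"
proof -
  have "bounded (J ` sublevel c)"
    by (intro compact_imp_bounded compact_continuous_image compact_sublevel \<open>c < 0\<close>
        continuous_on_subset[OF J_cont]) auto
  then obtain b where b: "\<And>x. x \<in> sublevel c \<Longrightarrow> \<bar>J x\<bar> \<le> b"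
    by (auto simp: bounded_iff)
  obtain n where n: "real n * \<kappa> > c + b"
    using reals_Archimedean3[OF \<open>0 < \<kappa>\<close>] by blast
  show ?thesis
  proof (rule exI[of _ n], rule ballI, rule ccontr)
    fix x assume x: "x \<in> sublevel c" and no: "\<not> (\<exists>j\<le>n. (h ^^ j) x \<in> B)"
    have it: "(h ^^ j) x \<in> sublevel c" for j
      by (rule descent_iterate[OF h(1,2) x])
    have "j \<le> n \<Longrightarrow> J ((h ^^ j) x) \<le> c - real j * \<kappa>" for j
    proof (induction j)
      case 0
      then show ?case using x by (simp add: sublevel_def)
    next
      case (Suc j)
      have "J (h ((h ^^ j) x)) \<le> J ((h ^^ j) x) - \<kappa>"
        using Suc.prems no by (intro h(3) it) auto
      then show ?case
        using Suc by (simp add: algebra_simps)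
    qed
    from this[of n] b[OF it[of n]] n show False
      by auto
  qed
qed

text \<open>Crossing the annulus \<open>\<rho>/2 \<le> |x - k| \<le> \<rho>\<close>, where the gradient is at least \<open>G\<close>, costs a definite amount
  of \<open>J\<close>: the sum of \<open>J\<close> and the clamped distance to \<open>k\<close> (weighted by \<open>G/2\<close>) still decreases.\<close>

lemma annulus_cost:
  assumes "0 < \<rho>" "0 < G"
    and h: "\<And>x. x \<in> coord_space N \<Longrightarrow> h x \<in> coord_space N"
      "\<And>x. x \<in> sublevel c \<Longrightarrow> J (h x) \<le> J x - enorm N (g x) * edist N (h x) x / 2"
      "\<And>x. x \<in> sublevel c \<Longrightarrow> edist N (h x) x \<le> \<rho> / 8"
    and G: "\<And>x. x \<in> sublevel c \<Longrightarrow> \<rho> / 2 \<le> edist N x k \<Longrightarrow> edist N x k \<le> \<rho> \<Longrightarrow> G \<le> enorm N (g x)"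
    and x: "x \<in> sublevel c" "edist N x k \<le> \<rho> / 2" "7 * \<rho> / 8 \<le> edist N ((h ^^ n) x) k"
  shows "J ((h ^^ n) x) + G * \<rho> / 8 \<le> J x"
proof -
  have h': "J (h x) \<le> J x" if "x \<in> sublevel c" for x
  proof -
    have "0 \<le> enorm N (g x) * edist N (h x) x" by (simp add: edist_def)
    then show ?thesis using h(2)[OF that] by linarith
  qed
  \<comment> \<open>The clamp stays \<rho>/8 inside both edges of the annulus. A step of length at
    most \<rho>/8 starting outside the annulus therefore leaves \<open>C\<close> unchanged, and no
    gradient bound is needed there.\<close>
  define C where "C y = max (5 * \<rho> / 8) (min (edist N y k) (7 * \<rho> / 8))" for y
  have step: "J (h y) + G / 2 * C (h y) \<le> J y + G / 2 * C y" if y: "y \<in> sublevel c" for y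
  proof -
    have tri: "\<bar>edist N (h y) k - edist N y k\<bar> \<le> edist N (h y) y"
      using edist_triangle[of N "h y" k y] edist_triangle[of N y k "h y"] edist_commute[of N y "h y"] by linarith
    show ?thesis
    proof (cases "\<rho> / 2 \<le> edist N y k \<and> edist N y k \<le> \<rho>")
      case True
      have "G * edist N (h y) y \<le> enorm N (g y) * edist N (h y) y"
        using G[OF y] True by (intro mult_right_mono) (auto simp: edist_def)
      moreover have "G * (C (h y) - C y) \<le> G * edist N (h y) y"
        using tri \<open>0 < G\<close> by (intro mult_left_mono) (auto simp: C_def)
      ultimately show ?thesis
        using h(2)[OF y] by (simp add: algebra_simps)
    next
      case False
      then have "C (h y) = C y"
        using tri h(3)[OF y] \<open>0 < \<rho>\<close> by (auto simp: C_def)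
      then show ?thesis using h'[OF y] by simp
    qed
  qed
  have "J ((h ^^ n) x) + G / 2 * C ((h ^^ n) x) \<le> J x + G / 2 * C x"
  proof (induction n)
    case (Suc n)
    then show ?case
      using step[OF descent_iterate[OF h(1) h' x(1), of n]] by simp
  qed simp
  moreover have "C x = 5 * \<rho> / 8" "C ((h ^^ n) x) = 7 * \<rho> / 8"
    using x \<open>0 < \<rho>\<close> by (auto simp: C_def)
  ultimately show ?thesis
    by (simp add: algebra_simps)
qed

text \<open>At a critical point the linear term vanishes, so the expansion with constant 1 bounds
  the change of \<open>J\<close> by the distance.\<close>

lemma critical_value_gap:
  assumes "finite crit" "0 < e"
  obtains r where "0 < r" "\<And>k x. k \<in> crit \<Longrightarrow> x \<in> coord_space N \<Longrightarrow> edist N x k < r \<Longrightarrow> \<bar>J x - J k\<bar> < e"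
proof -
  obtain R where R: "\<forall>x\<in>coord_space N. J x < 0 \<longrightarrow> enorm N x \<le> R"
    using bounded_sublevel by blast
  obtain \<delta> where \<delta>: "\<delta> > 0" "\<forall>x\<in>coord_space N. \<forall>v\<in>coord_space N. enorm N x \<le> R \<longrightarrow> enorm N v \<le> \<delta>
        \<longrightarrow> \<bar>J (\<lambda>i. x i + v i) - J x - einner N (g x) v\<bar> \<le> 1 * enorm N v"
    using gradient[of 1 R] by auto
  show thesis
  proof
    show "0 < min \<delta> e" using \<delta> assms by auto
    fix k x assume k: "k \<in> crit" and x: "x \<in> coord_space N" "edist N x k < min \<delta> e"
    define v where "v = (\<lambda>i. x i - k i)"
    have v: "v \<in> coord_space N" "enorm N v = edist N x k" "x = (\<lambda>i. k i + v i)"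
      using k x by (auto simp: v_def edist_def crit_def coord_space_def)
    have "\<bar>J (\<lambda>i. k i + v i) - J k - einner N (g k) v\<bar> \<le> 1 * enorm N v"
      by (rule \<delta>(2)[rule_format]) (use R k x v in \<open>auto simp: crit_def\<close>)
    moreover have "einner N (g k) v = 0"
      using k by (simp add: crit_def einner_def)
    ultimately show "\<bar>J x - J k\<bar> < e"
      using x(2) v by simp
  qed
qed

text \<open>The constants depend on each other in this order: \<rho> separates critical points,
  \<open>G\<close> bounds the gradient on annuli of radius \<rho>, \<open>r\<close> makes
  \<open>J\<close> nearly constant on small balls compared with \<open>G * \<rho>\<close>, and only
  then are the step map \<open>h\<close> and the number \<open>n\<close> of iterations
  fixed.\<close>

theorem card_crit:
  assumes fin: "finite crit"
  shows "2 * N \<le> card crit"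
proof (rule ccontr)
  assume "\<not> 2 * N \<le> card crit"
  define P where "P = {x \<in> crit. leading_pos x}"
  have nz: "x \<noteq> (\<lambda>_. 0)" if "x \<in> crit" for x
    using that J_0 by (auto simp: crit_def)
  have crit: "crit = P \<union> antipode ` P"
  proof (intro Set.set_eqI iffI)
    fix x assume x: "x \<in> crit"
    show "x \<in> P \<union> antipode ` P"
    proof (cases "leading_pos x")
      case False
      then have "antipode x \<in> P"
        using x antipode_in_crit leading_pos_antipode[OF nz[OF x]] by (auto simp: P_def)
      then show ?thesis by (force intro: image_eqI[of _ _ "antipode x"])
    qed (use x in \<open>auto simp: P_def\<close>)
  qed (auto simp: P_def antipode_in_crit)
  have "finite P" using fin by (simp add: P_def)
  have disj: "P \<inter> antipode ` P = {}"
    using leading_pos_antipode[OF nz] by (auto simp: P_def)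
  have "card (antipode ` P) = card P"
    by (intro card_image inj_onI) (simp add: fun_eq_iff)
  moreover have "card crit = card (P \<union> antipode ` P)"
    using crit by (rule arg_cong)
  ultimately have "card crit = 2 * card P"
    using card_Un_disjoint[OF \<open>finite P\<close> finite_imageI[OF \<open>finite P\<close>] disj] by linarith
  then have "card P < N"
    using \<open>\<not> 2 * N \<le> card crit\<close> by linarith
  then obtain e where e: "bij_betw e {..<card P} P"
    using ex_bij_betw_nat_finite[OF \<open>finite P\<close>] by (auto simp: atLeast0LessThan)

  let ?S = "{x \<in> coord_space N. enorm N x = r\<^sub>0}"
  have "?S = {x \<in> coord_space N. enorm N x \<le> r\<^sub>0} \<inter> {x. enorm N x = r\<^sub>0}" by auto
  moreover have "closed {x. enorm N x = r\<^sub>0}"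
    by (intro closed_Collect_eq continuous_intros)
  ultimately have "compact ?S"
    by (simp add: compact_Int_closed compact_enorm_ball)
  have "(\<lambda>i. if i = 0 then r\<^sub>0 else 0) \<in> ?S"
  proof -
    have "(enorm N (\<lambda>i. if i = 0 then r\<^sub>0 else 0))\<^sup>2 = r\<^sub>0\<^sup>2"
      unfolding enorm_power2 using N_pos by (simp add: if_distrib[of "\<lambda>x. x\<^sup>2"] cong: if_cong)
    then show ?thesis
      using r\<^sub>0_pos N_pos by (auto simp: coord_space_def power2_eq_iff_nonneg)
  qed
  then have "?S \<noteq> {}" by blast
  \<comment> \<open>The maximum of \<open>J\<close> on the sphere is still negative; the whole
    descent then stays in one compact sublevel.\<close>
  from continuous_attains_sup[OF \<open>compact ?S\<close> this continuous_on_subset[OF J_cont subset_UNIV]]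
  obtain c where c: "c < 0" "?S \<subseteq> sublevel c"
    using J_sphere by (force simp: sublevel_def)

  \<comment> \<open>With distances at least \<open>2 * \<rho>\<close>, the ball of radius \<rho>
    around a critical point contains no other one, so the annuli used for \<open>G\<close> are free
    of critical points.\<close>
  obtain \<rho> where \<rho>: "0 < \<rho>" "\<And>k k'. k \<in> crit \<Longrightarrow> k' \<in> crit \<Longrightarrow> k \<noteq> k' \<Longrightarrow> 2 * \<rho> \<le> edist N k k'"
  proof -
    let ?D = "(\<lambda>(k, k'). edist N k k') ` {(k, k') \<in> crit \<times> crit. k \<noteq> k'}"
    have "finite {(k, k') \<in> crit \<times> crit. k \<noteq> k'}"
      using fin by (auto intro: finite_subset[of _ "crit \<times> crit"])
    then have finD: "finite ?D" by (rule finite_imageI)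
    have pos: "\<forall>d\<in>?D. 0 < d"
    proof
      fix d assume "d \<in> ?D"
      then obtain k k' where k: "k \<in> crit" "k' \<in> crit" "k \<noteq> k'" "d = edist N k k'" by auto
      then have "(\<lambda>i. k i - k' i) \<in> coord_space N"
        by (auto simp: crit_def coord_space_def)
      moreover have "(\<lambda>i. k i - k' i) \<noteq> (\<lambda>_. 0)"
        using k(3) by (metis eq_iff_diff_eq_0 ext)
      ultimately have "d \<noteq> 0"
        unfolding k(4) edist_def by (simp only: enorm_eq_0_iff) simp
      then show "0 < d"
        using k enorm_nonneg[of N "\<lambda>i. k i - k' i"] unfolding edist_def by linarith
    qed
    obtain b where b: "0 < b" "\<forall>d\<in>?D. b \<le> d"
      using finite_positive_lower_bound[OF finD pos] by blast
    show thesis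
    proof (rule that[of "b / 2"])
      show "2 * (b / 2) \<le> edist N k k'" if "k \<in> crit" "k' \<in> crit" "k \<noteq> k'" for k k'
        using bspec[OF b(2), of "edist N k k'"] that by auto
    qed (use b in simp)
  qed

  obtain G where G: "0 < G" "\<And>x k. x \<in> sublevel c \<Longrightarrow> k \<in> crit \<Longrightarrow> \<rho> / 2 \<le> edist N x k \<Longrightarrow>
      edist N x k \<le> \<rho> \<Longrightarrow> G \<le> enorm N (g x)"
  proof -
    let ?C = "\<Union>k\<in>crit. {x. \<rho> / 2 \<le> edist N x k} \<inter> {x. edist N x k \<le> \<rho>}"
    have clC: "closed ?C"
      by (intro closed_UN fin ballI closed_Int closed_Collect_le continuous_intros)
    have disjC: "sublevel c \<inter> ?C \<inter> crit = {}"
    proof -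
      have False if "x \<in> crit" "k \<in> crit" "\<rho> / 2 \<le> edist N x k" "edist N x k \<le> \<rho>" for x k
        using \<rho>(2)[OF that(1,2)] that \<rho>(1) by (cases "x = k") auto
      then show ?thesis by blast
    qed
    obtain G where "0 < G" "\<forall>x\<in>sublevel c \<inter> ?C. G \<le> enorm N (g x)"
      using gradient_lower_bound[OF c(1) clC disjC] by blast
    then show thesis using that by blast
  qed

  \<comment> \<open>The tolerance is half of the crossing cost \<open>G * \<rho> / 8\<close>, since
    it is spent at both ends of a transit.\<close>
  obtain r\<^sub>1 where r\<^sub>1: "0 < r\<^sub>1" "\<And>k x. k \<in> crit \<Longrightarrow> x \<in> coord_space N \<Longrightarrow> edist N x k < r\<^sub>1 \<Longrightarrow> \<bar>J x - J k\<bar> < G * \<rho> / 16"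
    using critical_value_gap[OF fin, of "G * \<rho> / 16"] G \<rho> by auto
  define r where "r = min r\<^sub>1 (\<rho> / 2)"
  have r: "0 < r" "r \<le> \<rho> / 2"
    and Jr: "\<And>k x. k \<in> crit \<Longrightarrow> x \<in> coord_space N \<Longrightarrow> edist N x k < r \<Longrightarrow> \<bar>J x - J k\<bar> < G * \<rho> / 16"
    using r\<^sub>1 \<rho>(1) by (auto simp: r_def)
  let ?B = "\<Union>k\<in>crit. {x. edist N x k < r}"
  obtain \<epsilon>\<^sub>2 where \<epsilon>\<^sub>2: "0 < \<epsilon>\<^sub>2" "\<And>x. x \<in> sublevel c \<Longrightarrow> x \<notin> ?B \<Longrightarrow> \<epsilon>\<^sub>2 \<le> enorm N (g x)"
  proof -
    have "open ?B"
      by (intro open_UN ballI open_Collect_less continuous_intros)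
    then have clB: "closed (- ?B)" by (rule closed_Compl)
    have "x \<in> ?B" if "x \<in> crit" for x
      using r(1) that by (intro UN_I[of x]) auto
    then have disjB: "sublevel c \<inter> - ?B \<inter> crit = {}"
      by blast
    show thesis
      using gradient_lower_bound[OF c(1) clB disjB] that by (metis ComplI IntI)
  qed
  \<comment> \<open>The truncation parameter is half the gradient bound outside the small balls, so
    the guaranteed drop holds at every point outside them.\<close>
  obtain h \<kappa> where \<kappa>: "0 < \<kappa>" and h_cont: "continuous_on UNIV h"
    and h_odd: "\<And>x. x \<in> coord_space N \<Longrightarrow> h (antipode x) = antipode (h x)"
    and h_coord: "\<And>x. x \<in> coord_space N \<Longrightarrow> h x \<in> coord_space N"
    and h_desc: "\<And>x. x \<in> sublevel c \<Longrightarrow> J (h x) \<le> J x - enorm N (g x) * edist N (h x) x / 2"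
    and h_small: "\<And>x. x \<in> sublevel c \<Longrightarrow> edist N (h x) x \<le> \<rho> / 8"
    and h_drop: "\<And>x. x \<in> sublevel c \<Longrightarrow> 2 * (\<epsilon>\<^sub>2 / 2) \<le> enorm N (g x) \<Longrightarrow> J (h x) \<le> J x - \<kappa>"
  proof (rule descent_step[OF c(1), of "\<epsilon>\<^sub>2 / 2" "\<rho> / 8"])
    show "0 < \<epsilon>\<^sub>2 / 2" "0 < \<rho> / 8" using \<epsilon>\<^sub>2(1) \<rho>(1) by auto
  qed (rule that; blast)
  have h_le: "J (h x) \<le> J x" if "x \<in> sublevel c" for x
  proof -
    have "0 \<le> enorm N (g x) * edist N (h x) x" by (simp add: edist_def)
    then show ?thesis using h_desc[OF that] by linarith
  qed
  have it: "(h ^^ j) x \<in> sublevel c" if "x \<in> sublevel c" for x j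
    by (rule descent_iterate[OF h_coord h_le that])
  have it_coord: "(h ^^ j) x \<in> coord_space N" if "x \<in> coord_space N" for x j
    using that by (induction j) (auto simp: h_coord)
  have it_odd: "(h ^^ j) (antipode x) = antipode ((h ^^ j) x)" if "x \<in> coord_space N" for x j
    using that by (induction j) (auto simp: h_odd it_coord)
  have it_cont: "continuous_on UNIV (h ^^ j)" for j
  proof (induction j)
    case (Suc j)
    then show ?case
      by (auto intro!: continuous_on_compose continuous_on_subset[OF h_cont] simp del: comp_apply)
  qed (simp add: id_def)
  have h_drop': "J (h x) \<le> J x - \<kappa>" if "x \<in> sublevel c" "x \<notin> ?B" for x
    using h_drop[OF that(1)] \<epsilon>\<^sub>2(2)[OF that] by simp
  from visits_critical_ball[OF c(1) \<kappa> h_coord h_le h_drop']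
  obtain n where n: "\<forall>x\<in>sublevel c. \<exists>j\<le>n. (h ^^ j) x \<in> ?B" ..

  \<comment> \<open>Both ends have nearly the same value because
    \<open>J (antipode k) = J k\<close>, whereas the orbit has crossed the annulus around
    \<open>k\<close> and lost at least \<open>G * \<rho> / 8\<close>.\<close>
  have no_transit: False
    if x: "x \<in> sublevel c" and k: "k \<in> crit" and "j \<le> j'"
      and 1: "edist N ((h ^^ j) x) k < r" and 2: "edist N ((h ^^ j') x) (antipode k) < r" for x k j j'
  proof -
    let ?y = "(h ^^ j) x" and ?z = "(h ^^ j') x"
    have z: "?z = (h ^^ (j' - j)) ?y"
      using \<open>j \<le> j'\<close> by (metis comp_apply funpow_add le_add_diff_inverse2)
    have "k \<noteq> antipode k"
      using nz[OF k] by (auto simp: fun_eq_iff)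
    then have "2 * \<rho> \<le> edist N k (antipode k)"
      using \<rho>(2) k antipode_in_crit by blast
    also have "\<dots> \<le> edist N k ?z + edist N ?z (antipode k)"
      by (rule edist_triangle)
    finally have "7 * \<rho> / 8 \<le> edist N ?z k"
      using 2 r \<rho>(1) by (simp add: edist_commute)
    then have "J ?z + G * \<rho> / 8 \<le> J ?y"
      unfolding z using 1 r
      by (intro annulus_cost[OF \<rho>(1) G(1) h_coord h_desc h_small G(2)[OF _ k] it[OF x]]) auto
    moreover have "\<bar>J ?y - J k\<bar> < G * \<rho> / 16" "\<bar>J ?z - J (antipode k)\<bar> < G * \<rho> / 16"
      using it[OF x] 1 2 k antipode_in_crit[OF k] by (intro Jr; simp add: sublevel_def)+
    moreover have "J (antipode k) = J k"
      using k by (simp add: J_even crit_def)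
    ultimately show False by argo
  qed

  let ?X = "nsphere (N - 1)"
  let ?s = "\<lambda>(x :: nat \<Rightarrow> real) i. r\<^sub>0 * x i"
  have scaled: "?s x \<in> sublevel c" "?s x \<in> coord_space N" if "x \<in> topspace ?X" for x
  proof -
    have x: "(\<Sum>i<N. (x i)\<^sup>2) = 1" "\<And>i. i \<ge> N \<Longrightarrow> x i = 0"
      using that N_pos by (auto simp: nsphere lessThan_Suc_atMost[symmetric])
    then have "enorm N x = 1"
      by (simp add: enorm_def L2_set_def)
    then have "?s x \<in> ?S"
      using x r\<^sub>0_pos by (simp add: enorm_scale coord_space_def)
    then show "?s x \<in> sublevel c" "?s x \<in> coord_space N" using c by auto
  qed
  \<comment> \<open>Only the representatives \<open>e i\<close> are used; visits to their antipodes
    are visits of the antipodal orbit, because \<open>h\<close> is odd.\<close>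
  define U where "U i = {x \<in> topspace ?X. \<exists>j\<le>n. edist N ((h ^^ j) (?s x)) (e i) < r}" for i
  show False
  proof (rule lusternik_schnirelmann[of "card P" "N - 1" U])
    show "card P \<le> N - 1" using \<open>card P < N\<close> by simp
  next
    fix i assume "i < card P"
    have "open (\<Union>j\<in>{..n}. {x. edist N ((h ^^ j) (?s x)) (e i) < r})"
    proof (intro open_UN ballI open_Collect_less continuous_on_const)
      fix j
      have s: "continuous_on UNIV ?s"
        by (intro continuous_on_coordinatewise_then_product continuous_intros)
      have "continuous_on UNIV (\<lambda>x. (h ^^ j) (?s x))"
        using continuous_on_compose2[OF it_cont s] by simp
      then show "continuous_on UNIV (\<lambda>x. edist N ((h ^^ j) (?s x)) (e i))"
        by (rule continuous_on_compose2[OF continuous_on_edist[of UNIV]]) simp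
    qed
    moreover have "U i = topspace ?X \<inter> (\<Union>j\<in>{..n}. {x. edist N ((h ^^ j) (?s x)) (e i) < r})"
      by (auto simp: U_def)
    ultimately show "openin ?X (U i)"
      by (auto simp: nsphere openin_subtopology euclidean_product_topology)
  next
    fix i x assume "i < card P" "x \<in> U i"
    then obtain j where x: "x \<in> topspace ?X" and j: "edist N ((h ^^ j) (?s x)) (e i) < r"
      by (auto simp: U_def)
    have k: "e i \<in> crit"
      using e \<open>i < card P\<close> by (auto simp: P_def bij_betw_def)
    show "antipode x \<notin> U i"
    proof
      assume "antipode x \<in> U i"
      then obtain j' where "edist N ((h ^^ j') (antipode (?s x))) (e i) < r"
        by (auto simp: U_def)
      then have "edist N (antipode ((h ^^ j') (?s x))) (e i) < r"
        by (simp only: it_odd[OF scaled(2)[OF x]])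
      then have j': "edist N ((h ^^ j') (?s x)) (antipode (e i)) < r"
        using enorm_antipode[of N "\<lambda>m. (h ^^ j') (?s x) m + e i m"] by (simp add: edist_def)
      \<comment> \<open>Whichever visit comes first is the start of the transit; if it is the one
        near \<open>antipode (e i)\<close>, the transit ends near its antipode
        \<open>e i\<close>.\<close>
      show False
        using no_transit[OF scaled(1)[OF x] k _ j j']
          no_transit[OF scaled(1)[OF x] antipode_in_crit[OF k] _ j', of j] j by (cases j j' rule: linorder_le_cases) auto
    qed
  next
    fix x assume x: "x \<in> topspace ?X"
    then have ax: "antipode x \<in> topspace ?X"
      by (simp add: nsphere)
    obtain j k where j: "j \<le> n" "k \<in> crit" "edist N ((h ^^ j) (?s x)) k < r"
      using bspec[OF n scaled(1)[OF x]] by auto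
    have sgn: "\<exists>i<card P. y = e i" if "y \<in> P" for y
      using e that by (auto simp: bij_betw_def)
    from j(2) consider "k \<in> P" | k' where "k' \<in> P" "k = antipode k'"
      unfolding crit by blast
    then show "\<exists>i<card P. x \<in> U i \<or> antipode x \<in> U i"
    proof cases
      case 1
      then show ?thesis using sgn[OF 1] j x by (auto simp: U_def)
    next
      case 2
      have "edist N (antipode ((h ^^ j) (?s x))) k' < r"
        using j(3) 2 enorm_antipode[of N "\<lambda>m. (h ^^ j) (?s x) m + k' m"] by (simp add: edist_def)
      then have "edist N ((h ^^ j) (?s (antipode x))) k' < r"
        using it_odd[OF scaled(2)[OF x]] by simp
      then show ?thesis using sgn[OF 2(1)] j ax by (auto simp: U_def)
    qed
  qed
qed

end

section \<open>Antiderivatives and Rayleigh quotients\<close>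

text \<open>Evenness follows because \<open>F (- s) - F s\<close> has derivative zero when
  \<open>f\<close> is odd.\<close>

lemma odd_antiderivative:
  fixes f :: "real \<Rightarrow> real"
  assumes cont: "continuous_on UNIV f" and odd: "\<And>s. f (- s) = - f s"
  shows "\<exists>F. (\<forall>s. (F has_real_derivative f s) (at s)) \<and> F 0 = 0 \<and> (\<forall>s. F (- s) = F s)"
proof -
  define F\<^sub>0 where "F\<^sub>0 u = (LBINT y=0..u. f y)" for u :: real
  have F\<^sub>0: "(F\<^sub>0 has_real_derivative f s) (at s)" for s
  proof -
    let ?a = "- \<bar>s\<bar> - 1" and ?b = "\<bar>s\<bar> + 1"
    have "((\<lambda>u. LBINT y=ereal 0..u. f y) has_vector_derivative f s) (at s within {?a..?b})"
      by (rule interval_integral_FTC2) (auto intro: continuous_on_subset[OF cont])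
    moreover have "at s within {?a..?b} = at s"
      by (intro at_within_Icc_at) auto
    ultimately show ?thesis
      unfolding F\<^sub>0_def by (simp only: has_real_derivative_iff_has_vector_derivative zero_ereal_def)
  qed
  define F where "F s = F\<^sub>0 s - F\<^sub>0 0" for s
  have F: "(F has_real_derivative f s) (at s)" for s
    unfolding F_def by (auto intro!: derivative_eq_intros F\<^sub>0)
  have "((\<lambda>s. F (- s) - F s) has_real_derivative 0) (at s)" for s
  proof -
    have "((\<lambda>s. F (- s)) has_real_derivative f (- s) * (- 1)) (at s)"
      by (rule DERIV_chain2[OF F]) (auto intro!: derivative_eq_intros)
    then show ?thesis
      using F[of s] by (auto intro!: derivative_eq_intros simp: odd)
  qed
  then have "F (- s) - F s = F (- 0) - F 0" for s
    by (intro DERIV_isconst_all) blast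
  then show ?thesis
    using F by (intro exI[of _ F]) (auto simp: F_def)
qed

text \<open>Mean value theorem plus uniform continuity of \<open>f\<close> on an interval enlarged
  by 1, which is why \<delta> is capped at 1. This supplies the \<open>gradient\<close> axiom of the
  locale for each nonlinear term.\<close>

lemma antiderivative_uniform:
  fixes F f :: "real \<Rightarrow> real"
  assumes F: "\<And>s. (F has_real_derivative f s) (at s)" and cont: "continuous_on UNIV f" and "0 < \<omega>"
  shows "\<exists>\<delta>>0. \<forall>s t. \<bar>s\<bar> \<le> R \<longrightarrow> \<bar>t\<bar> \<le> \<delta> \<longrightarrow> \<bar>F (s + t) - F s - f s * t\<bar> \<le> \<omega> * \<bar>t\<bar>"
proof -
  have "uniformly_continuous_on {-R-1..R+1} f"
    by (intro compact_uniformly_continuous continuous_on_subset[OF cont]) auto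
  then obtain d where d: "d > 0" "\<And>x y. x \<in> {-R-1..R+1} \<Longrightarrow> y \<in> {-R-1..R+1} \<Longrightarrow> dist y x < d \<Longrightarrow> dist (f y) (f x) < \<omega>"
    using \<open>0 < \<omega>\<close> unfolding uniformly_continuous_on_def by metis
  show ?thesis
  proof (intro exI[of _ "min (d / 2) 1"] conjI allI impI)
    fix s t assume s: "\<bar>s\<bar> \<le> R" and t: "\<bar>t\<bar> \<le> min (d / 2) 1"
    have "\<exists>z. \<bar>z - s\<bar> \<le> \<bar>t\<bar> \<and> F (s + t) - F s = t * f z"
    proof (cases t "0::real" rule: linorder_cases)
      case less
      obtain z where "s + t < z" "z < s" "F s - F (s + t) = (s - (s + t)) * f z"
        using MVT2[of "s + t" s F f] less F by auto
      then show ?thesis by (intro exI[of _ z]) (auto simp: algebra_simps)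
    next
      case greater
      obtain z where "s < z" "z < s + t" "F (s + t) - F s = (s + t - s) * f z"
        using MVT2[of s "s + t" F f] greater F by auto
      then show ?thesis by (intro exI[of _ z]) auto
    qed auto
    then obtain z where z: "\<bar>z - s\<bar> \<le> \<bar>t\<bar>" "F (s + t) - F s = t * f z" by blast
    have "dist (f z) (f s) < \<omega>"
      using s t z d(1) by (intro d(2)) (auto simp: dist_real_def)
    then have "\<bar>t\<bar> * \<bar>f z - f s\<bar> \<le> \<bar>t\<bar> * \<omega>"
      by (intro mult_left_mono) (auto simp: dist_real_def)
    then show "\<bar>F (s + t) - F s - f s * t\<bar> \<le> \<omega> * \<bar>t\<bar>"
      unfolding z(2) by (simp add: abs_mult[symmetric] algebra_simps)
  qed (use d in auto)
qed

text \<open>The difference of \<open>F\<close> and the parabola is nondecreasing beyond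
  \<open>S\<close>, so its minimum over \<open>{0..S}\<close> is its minimum over the half line;
  evenness covers negative arguments.\<close>

lemma quadratic_lower_bound_at_infinity:
  fixes F f :: "real \<Rightarrow> real"
  assumes F: "\<And>s. (F has_real_derivative f s) (at s)" and even: "\<And>s. F (- s) = F s"
    and ev: "eventually (\<lambda>s. f s / s > \<beta>) at_top"
  shows "\<exists>C. \<forall>s. F s \<ge> \<beta> * s\<^sup>2 / 2 - C"
proof -
  obtain S where S: "S > 0" "\<And>s. s \<ge> S \<Longrightarrow> f s / s > \<beta>"
    using ev unfolding eventually_at_top_linorder by (metis (no_types) linorder_not_less gt_ex le_max_iff_disj max.absorb_iff2 max.cobounded1 less_le_trans)
  define \<phi> where "\<phi> s = F s - \<beta> * s\<^sup>2 / 2" for s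
  have \<phi>: "(\<phi> has_real_derivative f s - \<beta> * s) (at s)" for s
    unfolding \<phi>_def by (auto intro!: derivative_eq_intros F)
  have "continuous_on {0..S} \<phi>"
    by (intro DERIV_continuous_on) (use \<phi> in \<open>blast intro: has_field_derivative_at_within\<close>)
  then have "\<exists>s\<^sub>0\<in>{0..S}. \<forall>s\<in>{0..S}. \<phi> s\<^sub>0 \<le> \<phi> s"
    using S(1) by (intro continuous_attains_inf) auto
  then obtain s\<^sub>0 where s\<^sub>0: "\<forall>s\<in>{0..S}. \<phi> s\<^sub>0 \<le> \<phi> s"
    by blast
  have "\<phi> s\<^sub>0 \<le> \<phi> s" if "s \<ge> 0" for s
  proof (cases "s \<le> S")
    case False
    have "\<phi> S \<le> \<phi> s"
    proof (rule DERIV_nonneg_imp_nondecreasing[of S s])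
      fix x assume "S \<le> x" "x \<le> s"
      then have "f x - \<beta> * x \<ge> 0"
        using S(1) S(2)[of x] by (simp add: field_simps)
      then show "\<exists>y. (\<phi> has_real_derivative y) (at x) \<and> 0 \<le> y"
        using \<phi> by blast
    qed (use False in simp)
    then show ?thesis using bspec[OF s\<^sub>0, of S] S(1) by simp
  qed (use s\<^sub>0 that in simp)
  then have "\<phi> s\<^sub>0 \<le> \<phi> \<bar>s\<bar>" for s by simp
  moreover have "\<phi> \<bar>s\<bar> = F s - \<beta> * s\<^sup>2 / 2" for s
    using even[of s] by (cases "s \<ge> 0") (auto simp: \<phi>_def)
  ultimately have "F s \<ge> \<beta> * s\<^sup>2 / 2 - (- \<phi> s\<^sub>0)" for s
    by (smt (verit))
  then show ?thesis by blast
qed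

text \<open>The parabola minus \<open>F\<close> starts at 0 and has nonnegative derivative just to
  the right of it; evenness does the rest.\<close>

lemma quadratic_upper_bound_at_0:
  fixes F f :: "real \<Rightarrow> real"
  assumes F: "\<And>s. (F has_real_derivative f s) (at s)" and even: "\<And>s. F (- s) = F s" and "F 0 = 0"
    and ev: "eventually (\<lambda>s. f s / s < \<beta>) (at_right 0)"
  shows "\<exists>\<delta>>0. \<forall>s. \<bar>s\<bar> \<le> \<delta> \<longrightarrow> F s \<le> \<beta> * s\<^sup>2 / 2"
proof -
  obtain d where d: "d > 0" "\<And>s. 0 < s \<Longrightarrow> s < d \<Longrightarrow> f s / s < \<beta>"
    using ev unfolding eventually_at_right_field by auto
  define \<phi> where "\<phi> s = \<beta> * s\<^sup>2 / 2 - F s" for s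
  have \<phi>: "(\<phi> has_real_derivative \<beta> * s - f s) (at s)" for s
    unfolding \<phi>_def by (auto intro!: derivative_eq_intros F)
  have "\<phi> 0 \<le> \<phi> s" if "0 \<le> s" "s \<le> d / 2" for s
  proof (cases "s = 0")
    case False
    have "0 < s" using that False by simp
    then obtain z where "0 < z" "z < s" "\<phi> s - \<phi> 0 = (s - 0) * (\<beta> * z - f z)"
      using MVT2[of 0 s \<phi> "\<lambda>z. \<beta> * z - f z"] \<phi> by auto
    moreover have "\<beta> * z - f z \<ge> 0"
      using d(2)[of z] calculation that d(1) by (simp add: field_simps)
    ultimately show ?thesis
      using that by (metis diff_ge_0_iff_ge diff_zero mult_nonneg_nonneg)
  qed simp
  then have "\<phi> 0 \<le> \<phi> \<bar>s\<bar>" if "\<bar>s\<bar> \<le> d / 2" for s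
    using that by simp
  moreover have "\<phi> \<bar>s\<bar> = \<beta> * s\<^sup>2 / 2 - F s" for s
    using even[of s] by (cases "s \<ge> 0") (auto simp: \<phi>_def)
  moreover have "\<phi> 0 = 0"
    using \<open>F 0 = 0\<close> by (simp add: \<phi>_def)
  ultimately have "F s \<le> \<beta> * s\<^sup>2 / 2" if "\<bar>s\<bar> \<le> d / 2" for s
    using that by (smt (verit))
  then show ?thesis
    using d(1) by (intro exI[of _ "d / 2"]) auto
qed

text \<open>The first-order condition at a minimum, in the form used for the Rayleigh quotient. The
  test point minimizes the quadratic after \<open>c\<close> is replaced by a positive upper
  bound.\<close>

lemma nonneg_quadratic_imp_linear_0:
  fixes b c :: real
  assumes "\<And>t. 0 \<le> 2 * t * b + t\<^sup>2 * c"
  shows "b = 0"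
proof (rule ccontr)
  assume "b \<noteq> 0"
  define d where "d = \<bar>c\<bar> + 1"
  have d: "d > 0" "c \<le> d" by (auto simp: d_def)
  define t where "t = - b / d"
  have "t\<^sup>2 * c \<le> t\<^sup>2 * d"
    using d by (intro mult_left_mono) auto
  then have "0 \<le> 2 * t * b + t\<^sup>2 * d"
    using assms[of t] by linarith
  also have "\<dots> = - (b\<^sup>2 / d)"
    using d(1) by (simp add: t_def power2_eq_square field_simps)
  also have "\<dots> < 0"
    using \<open>b \<noteq> 0\<close> d(1) by simp
  finally show False by simp
qed

section \<open>The least eigenvalue as a lower bound of the Rayleigh quotient\<close>

lemma enorm_vec: "(enorm N x)\<^sup>2 = vec N x \<bullet> vec N x"
  unfolding enorm_power2 by (simp add: scalar_prod_def power2_eq_square atLeast0LessThan)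

lemma finite_eigenvalues:
  fixes A :: "real mat"
  assumes "A \<in> carrier_mat n n"
  shows "finite {l. eigenvalue A l}"
proof -
  have "char_poly A \<noteq> 0"
    using degree_monic_char_poly[OF assms] by auto
  then show ?thesis
    using poly_roots_finite by (simp add: eigenvalue_root_char_poly[OF assms])
qed

text \<open>The quotient attains a minimum \<mu> on the unit sphere, and a minimizer is an
  eigenvector for \<mu>. Hence the least eigenvalue is at most \<mu>, and homogeneity extends the
  bound to all vectors.\<close>

lemma min_eigenvalue_le_rayleigh:
  fixes M :: "real mat"
  assumes M: "M \<in> carrier_mat n N" and "N \<ge> 1"
  shows "Min {l. eigenvalue (transpose_mat M * M) l} * (enorm N x)\<^sup>2 \<le> (M *\<^sub>v vec N x) \<bullet> (M *\<^sub>v vec N x)"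
proof -
  let ?A = "transpose_mat M * M"
  have A: "?A \<in> carrier_mat N N" using M by simp
  define Q where "Q x = (M *\<^sub>v vec N x) \<bullet> (M *\<^sub>v vec N x)" for x
  have Q_sum: "Q x = (\<Sum>i<n. (\<Sum>j<N. M $$ (i, j) * x j)\<^sup>2)" for x
    using M by (simp add: Q_def scalar_prod_def power2_eq_square atLeast0LessThan)
  have Q_scale: "Q (\<lambda>i. c * x i) = c\<^sup>2 * Q x" for c x
    by (simp add: Q_sum mult.left_commute[of _ c] power_mult_distrib flip: sum_distrib_left)
  let ?S = "{x \<in> coord_space N. enorm N x = 1}"
  have "?S = {x \<in> coord_space N. enorm N x \<le> 1} \<inter> {x. enorm N x = 1}" by auto
  moreover have "closed {x. enorm N x = 1}"
    by (intro closed_Collect_eq continuous_intros)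
  ultimately have comp: "compact ?S"
    by (simp add: compact_Int_closed compact_enorm_ball)
  have "(\<lambda>i. if i = 0 then 1 else 0) \<in> ?S"
    using \<open>N \<ge> 1\<close> by (auto simp: coord_space_def enorm_def L2_set_def if_distrib[of "\<lambda>x. x\<^sup>2"] cong: if_cong)
  then have "?S \<noteq> {}" by blast
  moreover have "continuous_on ?S Q"
    unfolding Q_sum by (intro continuous_intros)
  ultimately obtain x\<^sub>0 where x\<^sub>0: "x\<^sub>0 \<in> ?S" "\<And>x. x \<in> ?S \<Longrightarrow> Q x\<^sub>0 \<le> Q x"
    using continuous_attains_inf[OF comp] by blast
  define \<mu> where "\<mu> = Q x\<^sub>0"
  have low': "\<mu> * (enorm N x)\<^sup>2 \<le> Q x" if "x \<in> coord_space N" for x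
  proof (cases "enorm N x = 0")
    case True
    then show ?thesis by (simp add: Q_sum sum_nonneg)
  next
    case False
    define c where "c = inverse (enorm N x)"
    have c: "c * enorm N x = 1" "0 \<le> c" using False by (auto simp: c_def)
    then have "(\<lambda>i. c * x i) \<in> ?S"
      using that by (simp add: enorm_scale coord_space_def)
    then have "\<mu> \<le> c\<^sup>2 * Q x"
      using x\<^sub>0(2) by (simp add: \<mu>_def flip: Q_scale)
    then have "\<mu> * (enorm N x)\<^sup>2 \<le> c\<^sup>2 * Q x * (enorm N x)\<^sup>2"
      by (rule mult_right_mono) simp
    also have "\<dots> = (c * enorm N x)\<^sup>2 * Q x"
      by (simp add: power_mult_distrib)
    finally show ?thesis by (simp add: c)
  qed
  have low: "\<mu> * (v \<bullet> v) \<le> (M *\<^sub>v v) \<bullet> (M *\<^sub>v v)" if "v \<in> carrier_vec N" for v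
  proof -
    let ?x = "\<lambda>i. if i < N then v $ i else 0"
    have "vec N ?x = v" using that by (intro eq_vecI) auto
    then show ?thesis
      using low'[of ?x] by (simp add: coord_space_def enorm_vec Q_def)
  qed
  define u where "u = vec N x\<^sub>0"
  have u: "u \<in> carrier_vec N" "u \<bullet> u = 1" "(M *\<^sub>v u) \<bullet> (M *\<^sub>v u) = \<mu>"
    using x\<^sub>0(1) by (auto simp: u_def \<mu>_def Q_def simp flip: enorm_vec)
  \<comment> \<open>The residual of the eigenvalue equation is itself taken as the direction of
    variation: the first variation \<open>b\<close> along it equals \<open>w \<bullet> w\<close>, so
    its vanishing forces \<open>w\<close> to be zero.\<close>
  define w where "w = ?A *\<^sub>v u - \<mu> \<cdot>\<^sub>v u"
  have w: "w \<in> carrier_vec N" using A u by (auto simp: w_def)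
  have Mu: "M *\<^sub>v u \<in> carrier_vec n" "M *\<^sub>v w \<in> carrier_vec n" using M u w by auto
  define b where "b = (M *\<^sub>v u) \<bullet> (M *\<^sub>v w) - \<mu> * (u \<bullet> w)"
  have "0 \<le> 2 * t * b + t\<^sup>2 * ((M *\<^sub>v w) \<bullet> (M *\<^sub>v w) - \<mu> * (w \<bullet> w))" for t
  proof -
    have "M *\<^sub>v (u + t \<cdot>\<^sub>v w) = M *\<^sub>v u + t \<cdot>\<^sub>v (M *\<^sub>v w)"
      using M u w by (simp add: mult_add_distrib_mat_vec[of _ n N] mult_mat_vec[of _ n N])
    then have 1: "(M *\<^sub>v (u + t \<cdot>\<^sub>v w)) \<bullet> (M *\<^sub>v (u + t \<cdot>\<^sub>v w))
        = \<mu> + 2 * t * ((M *\<^sub>v u) \<bullet> (M *\<^sub>v w)) + t\<^sup>2 * ((M *\<^sub>v w) \<bullet> (M *\<^sub>v w))"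
      using Mu u(3) comm_scalar_prod[of "M *\<^sub>v w" n "M *\<^sub>v u"]
      by (simp add: scalar_prod_add_distrib[of _ n] add_scalar_prod_distrib[of _ n] power2_eq_square algebra_simps)
    have 2: "(u + t \<cdot>\<^sub>v w) \<bullet> (u + t \<cdot>\<^sub>v w) = 1 + 2 * t * (u \<bullet> w) + t\<^sup>2 * (w \<bullet> w)"
      using u w comm_scalar_prod[of w N u]
      by (simp add: scalar_prod_add_distrib[of _ N] add_scalar_prod_distrib[of _ N] power2_eq_square algebra_simps)
    show ?thesis
      using low[of "u + t \<cdot>\<^sub>v w"] u(1) w unfolding 1 2 b_def by (simp add: algebra_simps)
  qed
  then have "b = 0" by (rule nonneg_quadratic_imp_linear_0)
  moreover have "b = w \<bullet> w"
  proof -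
    have "(M *\<^sub>v u) \<bullet> (M *\<^sub>v w) = (transpose_mat M *\<^sub>v (M *\<^sub>v u)) \<bullet> w"
      using transpose_vec_mult_scalar[OF M w Mu(1)] Mu w M
      by (metis comm_scalar_prod transpose_carrier_mat mult_mat_vec_carrier)
    also have "transpose_mat M *\<^sub>v (M *\<^sub>v u) = ?A *\<^sub>v u"
      using M u by (simp add: assoc_mult_mat_vec[of _ N n _ N])
    finally have "b = (?A *\<^sub>v u) \<bullet> w - (\<mu> \<cdot>\<^sub>v u) \<bullet> w"
      using u w by (simp add: b_def)
    also have "\<dots> = w \<bullet> w"
      unfolding w_def[symmetric] using A u w
      by (subst (3) w_def) (simp add: minus_scalar_prod_distrib[of _ N])
    finally show ?thesis .
  qed
  ultimately have "w = 0\<^sub>v N"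
    using w by (simp add: scalar_prod_def sum_nonneg_eq_0_iff flip: power2_eq_square) (auto simp: vec_eq_iff)
  then have "?A *\<^sub>v u = \<mu> \<cdot>\<^sub>v u"
    using A u unfolding w_def by (intro eq_vecI) (auto simp: vec_eq_iff)
  moreover have "u \<noteq> 0\<^sub>v N" using u by auto
  ultimately have "eigenvalue ?A \<mu>"
    using u(1) carrier_matD(1)[OF A] unfolding eigenvalue_def eigenvector_def
    by (intro exI[of _ u]) simp
  then have "Min {l. eigenvalue ?A l} \<le> \<mu>"
    using finite_eigenvalues[OF A] by (intro Min_le) auto
  then have "Min {l. eigenvalue ?A l} * (enorm N x)\<^sup>2 \<le> \<mu> * (vec N x \<bullet> vec N x)"
    unfolding enorm_vec[symmetric] by (rule mult_right_mono) simp
  also have "\<dots> \<le> (M *\<^sub>v vec N x) \<bullet> (M *\<^sub>v vec N x)"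
    by (rule low) simp
  finally show ?thesis .
qed

section \<open>The variational problem\<close>

text \<open>Grid point \<open>k\<close> carries coordinate \<open>k - 1\<close>; extension by zero
  encodes all four boundary conditions.\<close>

definition emb :: "nat \<Rightarrow> (nat \<Rightarrow> real) \<Rightarrow> int \<Rightarrow> real" where
  "emb N x k = (if 1 \<le> k \<and> k \<le> int N then x (nat (k - 1)) else 0)"

lemma embedE_vec: "embedE N (vec N x) = emb N x"
  by (auto simp: embedE_def emb_def fun_eq_iff)

lemma emb_outside: "k \<notin> {1..int N} \<Longrightarrow> emb N x k = 0"
  by (auto simp: emb_def)

lemma emb_Suc: "i < N \<Longrightarrow> emb N x (int i + 1) = x i"
  by (simp add: emb_def)

lemma emb_add: "emb N (\<lambda>i. x i + v i) k = emb N x k + emb N v k"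
  by (simp add: emb_def)

lemma emb_antipode: "emb N (antipode x) k = - emb N x k"
  by (simp add: emb_def)

lemma emb_0: "emb N (\<lambda>_. 0) k = 0"
  by (simp add: emb_def)

text \<open>Guarantees that distinct critical points yield distinct solutions.\<close>

lemma emb_inj_on: "inj_on (emb N) (coord_space N)"
proof (rule inj_onI, rule ext)
  fix x y i assume "x \<in> coord_space N" "y \<in> coord_space N" "emb N x = emb N y"
  then show "x i = y i"
    using emb_Suc[of i N x] emb_Suc[of i N y] by (cases "i < N") (auto simp: coord_space_def)
qed

lemma sum_int_shift: "(\<Sum>k\<in>{1..int N}. h k) = (\<Sum>i<N. h (int i + 1))"
  by (rule sum.reindex_bij_witness[of _ "\<lambda>i. int i + 1" "\<lambda>k. nat (k - 1)"]) auto

lemma emb_eq_sum: "emb N x k = (\<Sum>j<N. emb N (\<lambda>i. if i = j then 1 else 0) k * x j)"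
proof (cases "1 \<le> k \<and> k \<le> int N")
  case True
  then have "nat (k - 1) < N" by auto
  with True show ?thesis
    by (simp add: emb_def if_distrib[of "\<lambda>a. a * _"] cong: if_cong)
qed (auto simp: emb_def)

lemma unit_vec_eq_vec: "unit_vec N j = vec N (\<lambda>i. if i = j then 1 else 0)"
  by (auto simp: unit_vec_def)

lemma fdiff_sum: "fdiff (\<lambda>k. \<Sum>j\<in>A. h j k * c j) k = (\<Sum>j\<in>A. fdiff (h j) k * c j)"
  by (simp add: fdiff_def sum_subtractf left_diff_distrib)

lemma fdiff_emb: "fdiff (emb N x) k = (\<Sum>j<N. fdiff (emb N (\<lambda>i. if i = j then 1 else 0)) k * x j)"
  unfolding fdiff_sum[symmetric] by (simp add: fdiff_def flip: emb_eq_sum)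

lemma fdiff2_emb:
  "fdiff (fdiff (emb N x)) k = (\<Sum>j<N. fdiff (fdiff (emb N (\<lambda>i. if i = j then 1 else 0))) k * x j)"
proof -
  have "fdiff (emb N x) = (\<lambda>k. \<Sum>j<N. fdiff (emb N (\<lambda>i. if i = j then 1 else 0)) k * x j)"
    by (rule ext) (rule fdiff_emb)
  then show ?thesis
    by (simp only: fdiff_sum)
qed

lemma sum_emb_power2: "(\<Sum>k\<in>{1..int N}. (emb N x k)\<^sup>2) = (enorm N x)\<^sup>2"
  unfolding sum_int_shift enorm_power2 by (intro sum.cong) (auto simp: emb_Suc)

text \<open>The squared norm of \<open>Vmat N\<close> applied to \<open>x\<close>, indexed like
  \<open>q\<close>; likewise \<open>D2\<close> belongs to \<open>Wmat N\<close> and is indexed like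
  \<open>p\<close>.\<close>

definition D1 :: "nat \<Rightarrow> (nat \<Rightarrow> real) \<Rightarrow> real" where
  "D1 N x = (\<Sum>k\<in>{1..int N + 1}. (fdiff (emb N x) (k - 1))\<^sup>2)"

definition D2 :: "nat \<Rightarrow> (nat \<Rightarrow> real) \<Rightarrow> real" where
  "D2 N x = (\<Sum>k\<in>{1..int N + 2}. (fdiff (fdiff (emb N x)) (k - 2))\<^sup>2)"

lemma D1_ge: "N \<ge> 1 \<Longrightarrow> lambda1 N * (enorm N x)\<^sup>2 \<le> D1 N x"
proof -
  assume "N \<ge> 1"
  have V: "Vmat N \<in> carrier_mat (N + 1) N" by (simp add: Vmat_def)
  have "Vmat N *\<^sub>v vec N x = vec (N + 1) (\<lambda>i. fdiff (emb N x) (int i))"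
    by (intro eq_vecI) (simp_all add: fdiff_emb[of N x] Vmat_def scalar_prod_def unit_vec_eq_vec embedE_vec atLeast0LessThan)
  then have "(Vmat N *\<^sub>v vec N x) \<bullet> (Vmat N *\<^sub>v vec N x) = (\<Sum>i<N + 1. (fdiff (emb N x) (int i))\<^sup>2)"
    by (simp add: scalar_prod_def power2_eq_square atLeast0LessThan)
  also have "\<dots> = D1 N x"
    unfolding D1_def using sum_int_shift[of "\<lambda>k. (fdiff (emb N x) (k - 1))\<^sup>2" "N + 1"] by (simp add: add.commute)
  finally show ?thesis
    using min_eigenvalue_le_rayleigh[OF V \<open>N \<ge> 1\<close>, of x] by (simp add: lambda1_def)
qed

lemma D2_ge: "N \<ge> 1 \<Longrightarrow> lambda2 N * (enorm N x)\<^sup>2 \<le> D2 N x"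
proof -
  assume "N \<ge> 1"
  have W: "Wmat N \<in> carrier_mat (N + 2) N" by (simp add: Wmat_def)
  have "Wmat N *\<^sub>v vec N x = vec (N + 2) (\<lambda>i. fdiff (fdiff (emb N x)) (int i - 1))"
    by (intro eq_vecI) (simp_all add: fdiff2_emb[of N x] Wmat_def scalar_prod_def unit_vec_eq_vec embedE_vec atLeast0LessThan)
  then have "(Wmat N *\<^sub>v vec N x) \<bullet> (Wmat N *\<^sub>v vec N x) = (\<Sum>i<N + 2. (fdiff (fdiff (emb N x)) (int i - 1))\<^sup>2)"
    by (simp add: scalar_prod_def power2_eq_square atLeast0LessThan)
  also have "\<dots> = D2 N x"
    unfolding D2_def using sum_int_shift[of "\<lambda>k. (fdiff (fdiff (emb N x)) (k - 2))\<^sup>2" "N + 2"] by (simp add: add.commute)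
  finally show ?thesis
    using min_eigenvalue_le_rayleigh[OF W \<open>N \<ge> 1\<close>, of x] by (simp add: lambda2_def)
qed

lemma sum_shift_support:
  fixes h :: "int \<Rightarrow> 'a::comm_monoid_add"
  assumes "\<And>k. k \<notin> {a..b} \<Longrightarrow> h k = 0" "c \<le> a + m" "b + m \<le> d"
  shows "(\<Sum>k\<in>{c..d}. h (k - m)) = (\<Sum>k\<in>{a..b}. h k)"
proof -
  have "(\<Sum>k\<in>{c..d}. h (k - m)) = (\<Sum>k\<in>{a + m..b + m}. h (k - m))"
    using assms by (intro sum.mono_neutral_right) auto
  also have "\<dots> = (\<Sum>k\<in>{a..b}. h k)"
    by (rule sum.reindex_bij_witness[of _ "\<lambda>k. k + m" "\<lambda>k. k - m"]) auto
  finally show ?thesis .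
qed

lemma power2_diff_le: "(a - b)\<^sup>2 \<le> 2 * a\<^sup>2 + 2 * (b::real)\<^sup>2"
  using zero_le_power2[of "a + b"] by (simp add: power2_eq_square algebra_simps)

lemma D1_le: "D1 N x \<le> 4 * (enorm N x)\<^sup>2"
proof -
  have 1: "(\<Sum>k\<in>{1..int N + 1}. (emb N x (k - m))\<^sup>2) = (enorm N x)\<^sup>2" if "m \<in> {0, 1}" for m
    unfolding sum_emb_power2[symmetric] using that
    by (intro sum_shift_support[where h = "\<lambda>k. (emb N x k)\<^sup>2"]) (auto simp: emb_def)
  have "D1 N x \<le> (\<Sum>k\<in>{1..int N + 1}. 2 * (emb N x (k - 0))\<^sup>2 + 2 * (emb N x (k - 1))\<^sup>2)"
    unfolding D1_def fdiff_def using power2_diff_le by (intro sum_mono) simp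
  also have "\<dots> = 4 * (enorm N x)\<^sup>2"
    by (simp only: sum.distrib sum_distrib_left[symmetric] 1 insert_iff simp_thms)
  finally show ?thesis .
qed

text \<open>Each difference costs a factor 4 through \<open>power2_diff_le\<close>, as each of the
  two shifted sums keeps the full support; two differences give the constant 16 of
  \<open>alpha2\<close>.\<close>

lemma D2_le: "D2 N x \<le> 16 * (enorm N x)\<^sup>2"
proof -
  have 1: "(\<Sum>k\<in>{1..int N + 2}. (fdiff (emb N x) (k - m))\<^sup>2) = D1 N x" if "m \<in> {1, 2}" for m
  proof -
    have "(\<Sum>k\<in>{1..int N + 2}. (fdiff (emb N x) (k - m))\<^sup>2) = (\<Sum>k\<in>{0..int N}. (fdiff (emb N x) k)\<^sup>2)"
      using that by (intro sum_shift_support) (auto simp: fdiff_def emb_def)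
    also have "\<dots> = D1 N x"
      unfolding D1_def by (intro sum_shift_support[symmetric]) (auto simp: fdiff_def emb_def)
    finally show ?thesis .
  qed
  have "D2 N x \<le> (\<Sum>k\<in>{1..int N + 2}. 2 * (fdiff (emb N x) (k - 1))\<^sup>2 + 2 * (fdiff (emb N x) (k - 2))\<^sup>2)"
    unfolding D2_def
  proof (rule sum_mono)
    fix k
    have "fdiff (fdiff (emb N x)) (k - 2) = fdiff (emb N x) (k - 1) - fdiff (emb N x) (k - 2)"
      by (simp add: fdiff_def[of "fdiff _"])
    then show "(fdiff (fdiff (emb N x)) (k - 2))\<^sup>2 \<le> 2 * (fdiff (emb N x) (k - 1))\<^sup>2 + 2 * (fdiff (emb N x) (k - 2))\<^sup>2"
      by (simp only: power2_diff_le)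
  qed
  also have "\<dots> = 4 * D1 N x"
    by (simp only: sum.distrib sum_distrib_left[symmetric] 1 insert_iff simp_thms)
  finally show ?thesis using D1_le[of N x] by linarith
qed

definition bvp_form :: "nat \<Rightarrow> (int \<Rightarrow> real) \<Rightarrow> (int \<Rightarrow> real) \<Rightarrow> (nat \<Rightarrow> real) \<Rightarrow> (nat \<Rightarrow> real) \<Rightarrow> real" where
  "bvp_form N p q x z =
     (\<Sum>k\<in>{1..int N + 2}. p k * fdiff (fdiff (emb N x)) (k - 2) * fdiff (fdiff (emb N z)) (k - 2))
     - (\<Sum>k\<in>{1..int N + 1}. q k * fdiff (emb N x) (k - 1) * fdiff (emb N z) (k - 1))"

definition bvp_operator :: "(int \<Rightarrow> real) \<Rightarrow> (int \<Rightarrow> real) \<Rightarrow> (int \<Rightarrow> real) \<Rightarrow> int \<Rightarrow> real" where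
  "bvp_operator p q y k = fdiff (fdiff (\<lambda>j. p j * fdiff (fdiff y) (j - 2))) k + fdiff (\<lambda>j. q j * fdiff y (j - 1)) k"

text \<open>No boundary terms arise since \<open>emb N z\<close> vanishes outside
  \<open>{1..int N}\<close>. This identifies the gradient of the quadratic part of \<open>J\<close>
  with the linear part of the difference equation.\<close>

lemma summation_by_parts:
  "bvp_form N p q x z = (\<Sum>i<N. bvp_operator p q (emb N x) (int i + 1) * z i)"
proof -
  define a where "a k = p k * fdiff (fdiff (emb N x)) (k - 2)" for k
  define b where "b k = q k * fdiff (emb N x) (k - 1)" for k
  let ?z = "emb N z"
  have S: "(\<Sum>k\<in>{1..int N + M}. c k * ?z (k - m)) = (\<Sum>k\<in>{1..int N}. c (k + m) * ?z k)"
    if "0 \<le> m" "m \<le> M" for c :: "int \<Rightarrow> real" and m M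
    using sum_shift_support[of 1 "int N" "\<lambda>k. c (k + m) * ?z k" 1 m "int N + M"] that
    by (simp add: emb_outside)
  have "(\<Sum>k\<in>{1..int N + 2}. a k * fdiff (fdiff ?z) (k - 2))
      = (\<Sum>k\<in>{1..int N + 2}. a k * ?z (k - 0)) - 2 * (\<Sum>k\<in>{1..int N + 2}. a k * ?z (k - 1))
        + (\<Sum>k\<in>{1..int N + 2}. a k * ?z (k - 2))"
    unfolding sum_distrib_left sum_subtractf[symmetric] sum.distrib[symmetric]
    by (intro sum.cong) (auto simp: fdiff_def algebra_simps)
  also have "\<dots> = (\<Sum>k\<in>{1..int N}. fdiff (fdiff a) k * ?z k)"
    unfolding S[OF order_refl zero_le_numeral] S[OF zero_le_one one_le_numeral] S[OF zero_le_numeral order_refl]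
      sum_distrib_left sum_subtractf[symmetric] sum.distrib[symmetric]
    by (intro sum.cong) (auto simp: fdiff_def algebra_simps)
  finally have A: "(\<Sum>k\<in>{1..int N + 2}. a k * fdiff (fdiff ?z) (k - 2)) = (\<Sum>k\<in>{1..int N}. fdiff (fdiff a) k * ?z k)" .
  have "(\<Sum>k\<in>{1..int N + 1}. b k * fdiff ?z (k - 1))
      = (\<Sum>k\<in>{1..int N + 1}. b k * ?z (k - 0)) - (\<Sum>k\<in>{1..int N + 1}. b k * ?z (k - 1))"
    unfolding sum_subtractf[symmetric] by (intro sum.cong) (auto simp: fdiff_def algebra_simps)
  also have "\<dots> = - (\<Sum>k\<in>{1..int N}. fdiff b k * ?z k)"
    unfolding S[OF order_refl zero_le_one] S[OF zero_le_one order_refl] sum_subtractf[symmetric] sum_negf[symmetric]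
    by (intro sum.cong) (auto simp: fdiff_def algebra_simps)
  finally have B: "(\<Sum>k\<in>{1..int N + 1}. b k * fdiff ?z (k - 1)) = - (\<Sum>k\<in>{1..int N}. fdiff b k * ?z k)" .
  have "bvp_form N p q x z = (\<Sum>k\<in>{1..int N}. bvp_operator p q (emb N x) k * ?z k)"
    unfolding bvp_form_def a_def[symmetric] b_def[symmetric] A B
    by (simp add: bvp_operator_def distrib_right sum.distrib flip: a_def b_def)
  then show ?thesis
    unfolding sum_int_shift by (simp add: emb_Suc)
qed

lemma sum_weighted_square_add:
  fixes w a b :: "'a \<Rightarrow> real"
  shows "(\<Sum>k\<in>K. w k * (a k + b k) * (a k + b k))
    = (\<Sum>k\<in>K. w k * a k * a k) + 2 * (\<Sum>k\<in>K. w k * a k * b k) + (\<Sum>k\<in>K. w k * b k * b k)"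
  unfolding sum_distrib_left sum.distrib[symmetric] by (intro sum.cong) (auto simp: algebra_simps)

lemma bvp_form_add:
  "bvp_form N p q (\<lambda>i. x i + v i) (\<lambda>i. x i + v i)
    = bvp_form N p q x x + 2 * bvp_form N p q x v + bvp_form N p q v v"
proof -
  have 1: "fdiff (emb N (\<lambda>i. x i + v i)) = (\<lambda>k. fdiff (emb N x) k + fdiff (emb N v) k)"
    by (simp add: fdiff_def emb_add fun_eq_iff)
  have 2: "fdiff (fdiff (emb N (\<lambda>i. x i + v i))) k = fdiff (fdiff (emb N x)) k + fdiff (fdiff (emb N v)) k" for k
    unfolding 1 by (simp add: fdiff_def[of "fdiff _"] fdiff_def[of "\<lambda>k. _ k + _ k"])
  show ?thesis
    unfolding bvp_form_def 2 unfolding 1 sum_weighted_square_add by (simp add: algebra_simps)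
qed

text \<open>A weight of one sign calls for the lower eigenvalue bound of \<open>D1\<close>, a weight
  of the other sign for the upper bound 4; the case distinctions in \<open>eta\<close> and
  \<open>xi\<close> record which one applies. For \<open>p\<close> the sign is fixed by
  \<open>pmin N p \<ge> 0\<close>.\<close>

lemma bvp_form_bounds:
  assumes "N \<ge> 1" "pmin N p \<ge> 0"
  shows "bvp_form N p q x x \<ge> - alpha1 N p q * (enorm N x)\<^sup>2"
    and "bvp_form N p q x x \<le> - alpha2 N p q * (enorm N x)\<^sup>2"
proof -
  let ?n = "(enorm N x)\<^sup>2"
  let ?P = "\<Sum>k\<in>{1..int N + 2}. p k * (fdiff (fdiff (emb N x)) (k - 2))\<^sup>2"
  let ?Q = "\<Sum>k\<in>{1..int N + 1}. q k * (fdiff (emb N x) (k - 1))\<^sup>2"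
  have form: "bvp_form N p q x x = ?P - ?Q"
    by (simp add: bvp_form_def power2_eq_square mult.assoc)
  have p: "pmin N p \<le> p k" "p k \<le> pmax N p" if "k \<in> {1..int N + 2}" for k
    using that by (auto simp: pmin_def pmax_def)
  have q: "qmin N q \<le> q k" "q k \<le> qmax N q" if "k \<in> {1..int N + 1}" for k
    using that by (auto simp: qmin_def qmax_def)
  have P: "pmin N p * D2 N x \<le> ?P" "?P \<le> pmax N p * D2 N x"
    unfolding D2_def sum_distrib_left using p by (auto intro!: sum_mono mult_right_mono)
  have Q: "qmin N q * D1 N x \<le> ?Q" "?Q \<le> qmax N q * D1 N x"
    unfolding D1_def sum_distrib_left using q by (auto intro!: sum_mono mult_right_mono)
  have "0 \<le> pmax N p"
    using p[of 1] assms(2) by simp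
  have n: "0 \<le> ?n" by simp
  note D = D1_ge[OF assms(1), of x] D2_ge[OF assms(1), of x] D1_le[of N x] D2_le[of N x]
  have "pmin N p * (lambda2 N * ?n) \<le> pmin N p * D2 N x"
    using assms(2) D by (intro mult_left_mono) auto
  moreover have "qmax N q * D1 N x \<le> qmax N q * (eta N q * ?n)"
    using D by (cases "qmax N q < 0") (auto simp: eta_def intro: mult_left_mono mult_left_mono_neg)
  ultimately show "bvp_form N p q x x \<ge> - alpha1 N p q * ?n"
    using P(1) Q(2) assms(2) unfolding form alpha1_def eta'_def by (simp add: algebra_simps)
  have "pmax N p * D2 N x \<le> pmax N p * (16 * ?n)"
    using \<open>0 \<le> pmax N p\<close> D by (intro mult_left_mono) auto
  moreover have "qmin N q * (xi N q * ?n) \<le> qmin N q * D1 N x"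
    using D by (cases "qmin N q \<ge> 0") (auto simp: xi_def intro: mult_left_mono mult_left_mono_neg)
  ultimately show "bvp_form N p q x x \<le> - alpha2 N p q * ?n"
    using P(2) Q(1) unfolding form alpha2_def by (simp add: algebra_simps)
qed

section \<open>Continuity and symmetry of the form and the operator\<close>

lemma continuous_on_emb [continuous_intros]: "continuous_on S (\<lambda>x. emb N x k)"
  by (cases "1 \<le> k \<and> k \<le> int N") (auto simp: emb_def intro!: continuous_intros)

lemma continuous_on_bvp_form: "continuous_on S (\<lambda>x. bvp_form N p q x x)"
  unfolding bvp_form_def fdiff_def by (intro continuous_intros)

lemma continuous_on_bvp_operator: "continuous_on S (\<lambda>x. bvp_operator p q (emb N x) k)"
  unfolding bvp_operator_def fdiff_def by (intro continuous_intros)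

lemma bvp_form_antipode: "bvp_form N p q (antipode x) (antipode x) = bvp_form N p q x x"
  by (simp add: bvp_form_def fdiff_def emb_antipode algebra_simps)

lemma bvp_operator_antipode: "bvp_operator p q (emb N (antipode x)) k = - bvp_operator p q (emb N x) k"
  by (simp add: bvp_operator_def fdiff_def emb_antipode algebra_simps)

lemma bvp_form_0: "bvp_form N p q (\<lambda>_. 0) (\<lambda>_. 0) = 0"
  by (simp add: bvp_form_def fdiff_def emb_0)

lemma finite_common_delta:
  assumes "\<And>i. i < (N::nat) \<Longrightarrow> \<exists>\<delta>>0. P i \<delta>"
    and mono: "\<And>i \<delta> \<delta>'. P i \<delta> \<Longrightarrow> \<delta>' \<le> \<delta> \<Longrightarrow> P i \<delta>'"
  shows "\<exists>\<delta>>0::real. \<forall>i<N. P i \<delta>"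
  using assms(1)
proof (induction N)
  case 0
  then show ?case by (intro exI[of _ 1]) auto
next
  case (Suc N)
  then obtain a b where "0 < a" "\<forall>i<N. P i a" "0 < b" "P N b"
    by (metis less_Suc_eq)
  then show ?case
    by (intro exI[of _ "min a b"]) (auto simp: less_Suc_eq intro: mono)
qed

lemma sum_abs_coord_le: "(\<Sum>i<N. \<bar>v i\<bar>) \<le> real N * enorm N v"
  using sum_bounded_above[of "{..<N}" "\<lambda>i. \<bar>v i\<bar>" "enorm N v"] coord_le_enorm[of _ N v] by simp

theorem theorem6:
  fixes N :: nat
    and f :: "int \<Rightarrow> real \<Rightarrow> real"
    and p q :: "int \<Rightarrow> real"
    and Linf :: "int \<Rightarrow> ereal"
    and L0 :: "int \<Rightarrow> real"
  assumes "N \<ge> 1"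
    and cont: "\<forall>k\<in>{1..int N}. continuous_on UNIV (f k)"
    and odd: "\<forall>k\<in>{1..int N}. \<forall>s. f k (- s) = - f k s"
    and lim_inf: "\<forall>k\<in>{1..int N}. ((\<lambda>s. ereal (f k s / s)) \<longlongrightarrow> Linf k) at_top"
    and lim_0: "\<forall>k\<in>{1..int N}. ((\<lambda>s. f k s / s) \<longlongrightarrow> L0 k) (at_right 0)"
    and h1: "pmin N p \<ge> 0"
    and h2: "Min (Linf ` {1..int N}) > ereal (alpha1 N p q)"
    and h3: "Max (L0 ` {1..int N}) < alpha2 N p q"
  shows "\<exists>S. S \<subseteq> {y. is_solution N p q f y} \<and> finite S \<and> card S = 2 * N"
proof -
  define \<phi> where "\<phi> i = f (int i + 1)" for i :: nat
  have idx: "int i + 1 \<in> {1..int N}" if "i < N" for i using that by auto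
  have \<phi>_cont: "continuous_on UNIV (\<phi> i)" and \<phi>_odd: "\<phi> i (- s) = - \<phi> i s" if "i < N" for i s
    using idx[OF that] cont odd by (auto simp: \<phi>_def)
  have "\<exists>F. \<forall>i<N. (\<forall>s. (F i has_real_derivative \<phi> i s) (at s)) \<and> F i 0 = 0 \<and> (\<forall>s. F i (- s) = F i s)"
    using odd_antiderivative[OF \<phi>_cont \<phi>_odd] by metis
  then obtain F where F: "\<And>i s. i < N \<Longrightarrow> (F i has_real_derivative \<phi> i s) (at s)"
    and F_0: "\<And>i. i < N \<Longrightarrow> F i 0 = 0" and F_even: "\<And>i s. i < N \<Longrightarrow> F i (- s) = F i s"
    by blast
  define J where "J x = bvp_form N p q x x / 2 + (\<Sum>i<N. F i (x i))" for x
  define g where "g x = (\<lambda>i. if i < N then bvp_operator p q (emb N x) (int i + 1) + \<phi> i (x i) else 0)" for x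

  \<comment> \<open>A real slope strictly between \<open>alpha1\<close> and all limits at infinity,
    even if these are infinite. The surplus over \<open>alpha1\<close> becomes the coercivity
    constant in \<open>lower\<close>.\<close>
  obtain \<beta> where \<beta>: "alpha1 N p q < \<beta>" "ereal \<beta> < Min (Linf ` {1..int N})"
    using ereal_dense2[OF h2] by auto
  have "\<exists>C. \<forall>s. F i s \<ge> \<beta> * s\<^sup>2 / 2 - C" if "i < N" for i
  proof (rule quadratic_lower_bound_at_infinity[OF F F_even])
    have "ereal \<beta> < Linf (int i + 1)"
      by (rule less_le_trans[OF \<beta>(2)]) (intro Min_le finite_imageI imageI idx that finite_atLeastAtMost_int)
    moreover have "((\<lambda>s. ereal (\<phi> i s / s)) \<longlongrightarrow> Linf (int i + 1)) at_top"
      using lim_inf idx[OF that] by (auto simp: \<phi>_def)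
    ultimately have "eventually (\<lambda>s. ereal \<beta> < ereal (\<phi> i s / s)) at_top"
      by (intro order_tendstoD(1))
    then show "eventually (\<lambda>s. \<phi> i s / s > \<beta>) at_top" by simp
  qed (use that in auto)
  then obtain C where C: "\<And>i s. i < N \<Longrightarrow> F i s \<ge> \<beta> * s\<^sup>2 / 2 - C i" by metis
  have lower: "J x \<ge> (\<beta> - alpha1 N p q) / 2 * (enorm N x)\<^sup>2 - (\<Sum>i<N. C i)" for x
  proof -
    have "(\<Sum>i<N. \<beta> * (x i)\<^sup>2 / 2 - C i) \<le> (\<Sum>i<N. F i (x i))"
      by (intro sum_mono) (use C in auto)
    also have "(\<Sum>i<N. \<beta> * (x i)\<^sup>2 / 2 - C i) = \<beta> / 2 * (enorm N x)\<^sup>2 - (\<Sum>i<N. C i)"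
      by (simp add: enorm_power2 sum_subtractf sum_distrib_left)
    finally show ?thesis
      using bvp_form_bounds(1)[OF \<open>N \<ge> 1\<close> h1, of q x] unfolding J_def by (simp add: algebra_simps diff_divide_distrib)
  qed

  \<comment> \<open>The midpoint leaves room on both sides: above the slopes at 0 for the bound on
    \<open>F\<close>, below \<open>alpha2\<close> for strict negativity of \<open>J\<close> on the
    small sphere.\<close>
  define \<beta>' where "\<beta>' = (Max (L0 ` {1..int N}) + alpha2 N p q) / 2"
  have \<beta>': "\<beta>' < alpha2 N p q" "Max (L0 ` {1..int N}) < \<beta>'"
    using h3 by (auto simp: \<beta>'_def)
  have "\<exists>\<delta>>0. \<forall>i<N. \<forall>s. \<bar>s\<bar> \<le> \<delta> \<longrightarrow> F i s \<le> \<beta>' * s\<^sup>2 / 2"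
  proof (rule finite_common_delta)
    fix i assume "i < N"
    show "\<exists>\<delta>>0. \<forall>s. \<bar>s\<bar> \<le> \<delta> \<longrightarrow> F i s \<le> \<beta>' * s\<^sup>2 / 2"
    proof (rule quadratic_upper_bound_at_0[OF F F_even])
      have "L0 (int i + 1) < \<beta>'"
        by (rule le_less_trans[OF _ \<beta>'(2)]) (intro Max_ge finite_imageI imageI idx \<open>i < N\<close> finite_atLeastAtMost_int)
      moreover have "((\<lambda>s. \<phi> i s / s) \<longlongrightarrow> L0 (int i + 1)) (at_right 0)"
        using lim_0 idx[OF \<open>i < N\<close>] by (auto simp: \<phi>_def)
      ultimately show "eventually (\<lambda>s. \<phi> i s / s < \<beta>') (at_right 0)"
        by (intro order_tendstoD(2))
    qed (use \<open>i < N\<close> F_0 in auto)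
  qed auto
  then obtain r\<^sub>0 where r\<^sub>0: "r\<^sub>0 > 0" "\<And>i s. i < N \<Longrightarrow> \<bar>s\<bar> \<le> r\<^sub>0 \<Longrightarrow> F i s \<le> \<beta>' * s\<^sup>2 / 2"
    by blast
  have upper: "J x < 0" if "enorm N x = r\<^sub>0" for x
  proof -
    have "(\<Sum>i<N. F i (x i)) \<le> (\<Sum>i<N. \<beta>' * (x i)\<^sup>2 / 2)"
      using coord_le_enorm[of _ N x] that by (intro sum_mono r\<^sub>0(2)) auto
    also have "\<dots> = \<beta>' / 2 * (enorm N x)\<^sup>2"
      by (simp add: enorm_power2 sum_distrib_left)
    finally have "J x \<le> (\<beta>' - alpha2 N p q) / 2 * r\<^sub>0\<^sup>2"
      using bvp_form_bounds(2)[OF \<open>N \<ge> 1\<close> h1, of q x] that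
      unfolding J_def by (simp add: algebra_simps diff_divide_distrib)
    also have "\<dots> < 0"
      using \<beta>'(1) r\<^sub>0(1) by (intro mult_neg_pos) auto
    finally show ?thesis .
  qed

  interpret even_functional N J g r\<^sub>0
  proof
    show "N \<ge> 1" by fact
    show "0 < r\<^sub>0" by (rule r\<^sub>0(1))
    show "J (antipode x) = J x" for x
      by (simp add: J_def bvp_form_antipode F_even)
    show "J (\<lambda>_. 0) = 0"
      by (simp add: J_def bvp_form_0 F_0)
    show "g (antipode x) = antipode (g x)" for x
      by (auto simp: g_def bvp_operator_antipode \<phi>_odd)
    show "g x \<in> coord_space N" for x
      by (simp add: g_def coord_space_def)
    show "continuous_on UNIV J"
    proof -
      have "continuous_on UNIV (\<lambda>x::nat \<Rightarrow> real. F i (x i))" if "i < N" for i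
      proof (rule continuous_on_compose2[of UNIV "F i"])
        show "continuous_on UNIV (F i)"
          using F[OF that] by (intro continuous_at_imp_continuous_on) (blast intro: DERIV_isCont)
      qed (auto intro: continuous_intros)
      then show ?thesis
        unfolding J_def by (intro continuous_intros continuous_on_bvp_form) auto
    qed
    show "continuous_on UNIV (\<lambda>x. g x i)" for i
    proof (cases "i < N")
      case True
      have "continuous_on UNIV (\<lambda>x::nat \<Rightarrow> real. \<phi> i (x i))"
        by (rule continuous_on_compose2[OF \<phi>_cont[OF True]]) (auto intro: continuous_intros)
      then show ?thesis
        using True unfolding g_def by (auto intro!: continuous_intros continuous_on_bvp_operator)
    qed (simp add: g_def)
    show "J x < 0" if "enorm N x = r\<^sub>0" for x
      using that by (rule upper)
    show "\<exists>R. \<forall>x\<in>coord_space N. J x < 0 \<longrightarrow> enorm N x \<le> R"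
    proof (intro exI ballI impI)
      fix x assume "J x < 0"
      let ?d = "(\<beta> - alpha1 N p q) / 2"
      have "?d > 0" using \<beta>(1) by simp
      have "?d * (enorm N x)\<^sup>2 < (\<Sum>i<N. C i)"
        using lower[of x] \<open>J x < 0\<close> by linarith
      then have "(enorm N x)\<^sup>2 < (\<Sum>i<N. C i) / ?d"
        using \<open>?d > 0\<close> by (simp add: pos_less_divide_eq mult.commute)
      then show "enorm N x \<le> sqrt ((\<Sum>i<N. C i) / ?d)"
        by (intro real_le_rsqrt) simp
    qed
    fix \<omega> R :: real assume "0 < \<omega>"
    \<comment> \<open>The sum of the coordinates' absolute values is at most \<open>N\<close> times
      the norm, so the nonlinear terms use up half of \<omega>; the quadratic remainder, small for
      \<open>enorm N v \<le> \<omega> / A\<close>, uses the other half.\<close>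
    define \<omega>' where "\<omega>' = \<omega> / (2 * real N)"
    have "0 < \<omega>'" using \<open>0 < \<omega>\<close> \<open>N \<ge> 1\<close> by (simp add: \<omega>'_def)
    have "\<exists>\<delta>>0. \<forall>i<N. \<forall>s t. \<bar>s\<bar> \<le> R \<longrightarrow> \<bar>t\<bar> \<le> \<delta> \<longrightarrow> \<bar>F i (s + t) - F i s - \<phi> i s * t\<bar> \<le> \<omega>' * \<bar>t\<bar>"
      by (rule finite_common_delta, rule antiderivative_uniform[OF F \<phi>_cont \<open>0 < \<omega>'\<close>]) auto
    then obtain \<delta> where \<delta>: "\<delta> > 0" "\<And>i s t. i < N \<Longrightarrow> \<bar>s\<bar> \<le> R \<Longrightarrow> \<bar>t\<bar> \<le> \<delta> \<Longrightarrow>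
        \<bar>F i (s + t) - F i s - \<phi> i s * t\<bar> \<le> \<omega>' * \<bar>t\<bar>"
      by blast
    define A where "A = \<bar>alpha1 N p q\<bar> + \<bar>alpha2 N p q\<bar> + 1"
    have "A > 0" by (simp add: A_def)
    have formb: "\<bar>bvp_form N p q v v\<bar> \<le> A * (enorm N v)\<^sup>2" for v
    proof -
      have "bvp_form N p q v v \<le> A * (enorm N v)\<^sup>2"
        by (rule order_trans[OF bvp_form_bounds(2)[OF \<open>N \<ge> 1\<close> h1]]) (rule mult_right_mono, auto simp: A_def)
      moreover have "- A * (enorm N v)\<^sup>2 \<le> bvp_form N p q v v"
        by (rule order_trans[OF _ bvp_form_bounds(1)[OF \<open>N \<ge> 1\<close> h1]]) (rule mult_right_mono, auto simp: A_def)
      ultimately show ?thesis by (simp add: abs_le_iff)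
    qed
    show "\<exists>\<delta>>0. \<forall>x\<in>coord_space N. \<forall>v\<in>coord_space N. enorm N x \<le> R \<longrightarrow> enorm N v \<le> \<delta>
        \<longrightarrow> \<bar>J (\<lambda>i. x i + v i) - J x - einner N (g x) v\<bar> \<le> \<omega> * enorm N v"
    proof (intro exI[of _ "min \<delta> (\<omega> / A)"] conjI ballI impI)
      fix x v assume x: "enorm N x \<le> R" and v: "enorm N v \<le> min \<delta> (\<omega> / A)"
      have ip: "einner N (g x) v = bvp_form N p q x v + (\<Sum>i<N. \<phi> i (x i) * v i)"
        unfolding summation_by_parts einner_def sum.distrib[symmetric]
        by (intro sum.cong) (auto simp: g_def distrib_right)
      have split: "J (\<lambda>i. x i + v i) - J x - einner N (g x) v
          = bvp_form N p q v v / 2 + (\<Sum>i<N. F i (x i + v i) - F i (x i) - \<phi> i (x i) * v i)"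
        unfolding J_def ip bvp_form_add by (simp add: sum_subtractf add_divide_distrib)
      have "\<bar>\<Sum>i<N. F i (x i + v i) - F i (x i) - \<phi> i (x i) * v i\<bar> \<le> (\<Sum>i<N. \<bar>F i (x i + v i) - F i (x i) - \<phi> i (x i) * v i\<bar>)"
        by (rule sum_abs)
      also have "\<dots> \<le> (\<Sum>i<N. \<omega>' * \<bar>v i\<bar>)"
      proof (intro sum_mono \<delta>(2))
        fix i assume "i \<in> {..<N}"
        then show "i < N" "\<bar>x i\<bar> \<le> R" "\<bar>v i\<bar> \<le> \<delta>"
          using coord_le_enorm[of i N x] coord_le_enorm[of i N v] x v by auto
      qed
      also have "\<dots> \<le> \<omega>' * (real N * enorm N v)"
        unfolding sum_distrib_left[symmetric] using \<open>0 < \<omega>'\<close> by (intro mult_left_mono sum_abs_coord_le) auto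
      also have "\<dots> = \<omega> / 2 * enorm N v"
        using \<open>N \<ge> 1\<close> by (simp add: \<omega>'_def)
      finally have "\<bar>\<Sum>i<N. F i (x i + v i) - F i (x i) - \<phi> i (x i) * v i\<bar> \<le> \<omega> / 2 * enorm N v" .
      moreover have "\<bar>bvp_form N p q v v\<bar> \<le> \<omega> * enorm N v"
      proof -
        have "A * enorm N v \<le> \<omega>"
          using v \<open>A > 0\<close> by (simp add: pos_le_divide_eq mult.commute)
        then have "A * enorm N v * enorm N v \<le> \<omega> * enorm N v"
          by (rule mult_right_mono) simp
        then show ?thesis
          using formb[of v] by (simp add: power2_eq_square mult.assoc)
      qed
      ultimately show "\<bar>J (\<lambda>i. x i + v i) - J x - einner N (g x) v\<bar> \<le> \<omega> * enorm N v"
        unfolding split by linarith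
    qed (use \<delta>(1) \<open>0 < \<omega>\<close> \<open>A > 0\<close> in auto)
  qed

  have sol: "is_solution N p q f (emb N x)" if "x \<in> crit" for x
    unfolding is_solution_def
  proof (intro conjI allI ballI impI)
    fix k assume k: "k \<in> {1..int N}"
    define i where "i = nat (k - 1)"
    have i: "i < N" "k = int i + 1" using k by (auto simp: i_def)
    have "g x i = 0" using that by (simp add: crit_def)
    then show "fdiff (fdiff (\<lambda>j. p j * fdiff (fdiff (emb N x)) (j - 2))) k
        + fdiff (\<lambda>j. q j * fdiff (emb N x) (j - 1)) k + f k (emb N x k) = 0"
      using i emb_Suc[OF i(1), of x] by (simp add: g_def \<phi>_def bvp_operator_def)
  qed (auto simp: emb_def)
  \<comment> \<open>With infinitely many critical points any \<open>2 * N\<close> of them suffice;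
    the topological argument is needed only in the finite case.\<close>
  have "\<exists>T. T \<subseteq> crit \<and> finite T \<and> card T = 2 * N"
  proof (cases "finite crit")
    case True
    then show ?thesis
      using card_crit obtain_subset_with_card_n[of "2 * N" crit] by metis
  next
    case False
    then show ?thesis using infinite_arbitrarily_large by metis
  qed
  then obtain T where T: "T \<subseteq> crit" "finite T" "card T = 2 * N" by blast
  have "inj_on (emb N) T"
    using T(1) by (intro inj_on_subset[OF emb_inj_on]) (auto simp: crit_def)
  then show ?thesis
    using T sol by (intro exI[of _ "emb N ` T"]) (auto simp: card_image)
qed

end
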